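(* Let $m,n$ be distinct positive integers. Given a representation of $BS(1,m;1,n)$ into $\mathrm{Diff}^1_+([0,1])$, denote by $f,g,h$ the images of $a,b,c$, respectively. Then the interiors of the supports of $g$ and $h$ are disjoint. In particular, $g$ and $h$ commute, hence the action is not faithful.
   Context: For positive integers $m,n$, $BS(1,m;1,n):=\langle a,b,c\mid aba^{-1}=b^m,\ aca^{-1}=c^n\rangle$. $\mathrm{Diff}^1_+([0,1])$ is the group of orientation-preserving $C^1$ diffeomorphisms of $[0,1]$. The support of a diffeomorphism is the closure of the set of points it moves.
   Formalization: The formal theorem takes distinct m,n ≥ 2 instead of distinct positive integers: for m=1 (likewise n=1) the claim fails, e.g. a,b ↦ (x↦nx), c ↦ (x↦x+1) on the line compactified to [0,1] gives g,h with full support that do not commute. *)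

theory Defs
  imports "HOL-Analysis.Analysis" "HOL-Algebra.Bij"
begin

text \<open>
  A letter \<open>(x, True)\<close> stands for the generator \<open>x\<close> and \<open>(x, False)\<close> for its formal inverse.
  A presentation is given by a set of pairs of words \<open>(l, r)\<close>, each read as the relation \<open>l = r\<close>.
\<close>

type_synonym 'x gword = "('x \<times> bool) list"

inductive word_eq :: "('x gword \<times> 'x gword) set \<Rightarrow> 'x gword \<Rightarrow> 'x gword \<Rightarrow> bool"
  for R where
  refl: "word_eq R w w"
| sym: "word_eq R u v \<Longrightarrow> word_eq R v u"
| trans: "word_eq R u v \<Longrightarrow> word_eq R v w \<Longrightarrow> word_eq R u w"
| cancel: "word_eq R (u @ [(x, e), (x, \<not> e)] @ v) (u @ v)"
| relation: "(l, r) \<in> R \<Longrightarrow> word_eq R (u @ l @ v) (u @ r @ v)"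

definition word_class :: "('x gword \<times> 'x gword) set \<Rightarrow> 'x gword \<Rightarrow> 'x gword set" where
  "word_class R w = {v. word_eq R w v}"

definition presented_group :: "('x gword \<times> 'x gword) set \<Rightarrow> 'x gword set monoid" where
  "presented_group R =
     \<lparr>carrier = range (word_class R),
      mult = (\<lambda>A B. \<Union>u\<in>A. \<Union>v\<in>B. word_class R (u @ v)),
      one = word_class R []\<rparr>"

lemma word_eq_append:
  assumes "word_eq R u u'" "word_eq R v v'"
  shows "word_eq R (u @ v) (u' @ v')"
proof -
  have l: "word_eq R (p @ s @ q) (p @ t @ q)" if "word_eq R s t" for p q s t
    using that
  proof (induction arbitrary: p q)
    case (cancel u x e v)
    show ?case using word_eq.cancel[of R "p @ u" x e "v @ q"] by simp
  next
    case (relation l r u v)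
    then show ?case using word_eq.relation[of l r R "p @ u" "v @ q"] by simp
  next
    case (sym s t)
    show ?case by (rule word_eq.sym[OF sym.IH])
  next
    case (trans s t t')
    show ?case by (rule word_eq.trans[OF trans.IH])
  qed (rule word_eq.refl)
  have "word_eq R (u @ v) (u' @ v)" "word_eq R (u' @ v) (u' @ v')"
    using l[OF assms(1), of "[]" v] l[OF assms(2), of u' "[]"] by simp_all
  then show ?thesis by (rule word_eq.trans)
qed

lemma word_class_eq_iff: "word_class R u = word_class R v \<longleftrightarrow> word_eq R u v"
  unfolding word_class_def set_eq_iff mem_Collect_eq
  by (metis word_eq.refl word_eq.sym word_eq.trans)

lemma presented_group_mult:
  "word_class R u \<otimes>\<^bsub>presented_group R\<^esub> word_class R v = word_class R (u @ v)"
proof -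
  have "word_class R (u' @ v') = word_class R (u @ v)"
    if "u' \<in> word_class R u" "v' \<in> word_class R v" for u' v'
    unfolding word_class_eq_iff using that unfolding word_class_def mem_Collect_eq
    by (intro word_eq_append word_eq.sym[of R u] word_eq.sym[of R v])
  moreover have "w \<in> word_class R w" for w
    by (simp add: word_class_def word_eq.refl)
  ultimately have "(\<Union>u'\<in>word_class R u. \<Union>v'\<in>word_class R v. word_class R (u' @ v')) = word_class R (u @ v)"
    by blast
  then show ?thesis by (simp add: presented_group_def)
qed

lemma word_inverse_left: "word_eq R (rev (map (map_prod id Not) w) @ w) []"
proof (induction w)
  case Nil
  show ?case by (simp add: word_eq.refl)
next
  case (Cons z w)
  obtain x e where z: "z = (x, e)" by (cases z)
  have "word_eq R (rev (map (map_prod id Not) w) @ [(x, \<not> e), (x, \<not> \<not> e)] @ w)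
          (rev (map (map_prod id Not) w) @ w)"
    by (rule word_eq.cancel)
  from word_eq.trans[OF this Cons.IH] show ?case by (simp add: z id_def)
qed

lemma group_presented_group: "group (presented_group R)"
proof (rule groupI)
  fix x assume "x \<in> carrier (presented_group R)"
  then obtain w where x: "x = word_class R w" by (auto simp: presented_group_def)
  have "word_class R (rev (map (map_prod id Not) w)) \<otimes>\<^bsub>presented_group R\<^esub> x
          = \<one>\<^bsub>presented_group R\<^esub>"
    unfolding x presented_group_mult
    by (simp add: presented_group_def word_class_eq_iff word_inverse_left del: map_prod_simp)
  then show "\<exists>y\<in>carrier (presented_group R). y \<otimes>\<^bsub>presented_group R\<^esub> x = \<one>\<^bsub>presented_group R\<^esub>"
    by (rule bexI) (simp add: presented_group_def)
next
  have one: "\<one>\<^bsub>presented_group R\<^esub> = word_class R []"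
    and car: "carrier (presented_group R) = range (word_class R)"
    by (simp_all add: presented_group_def)
  show "\<one>\<^bsub>presented_group R\<^esub> \<in> carrier (presented_group R)"
    by (simp add: one car)
  show "x \<otimes>\<^bsub>presented_group R\<^esub> y \<in> carrier (presented_group R)"
    if "x \<in> carrier (presented_group R)" "y \<in> carrier (presented_group R)" for x y
    using that by (auto simp: car presented_group_mult)
  show "x \<otimes>\<^bsub>presented_group R\<^esub> y \<otimes>\<^bsub>presented_group R\<^esub> z
          = x \<otimes>\<^bsub>presented_group R\<^esub> (y \<otimes>\<^bsub>presented_group R\<^esub> z)"
    if "x \<in> carrier (presented_group R)" "y \<in> carrier (presented_group R)"
      "z \<in> carrier (presented_group R)" for x y z
    using that by (auto simp: car presented_group_mult)
  show "\<one>\<^bsub>presented_group R\<^esub> \<otimes>\<^bsub>presented_group R\<^esub> x = x"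
    if "x \<in> carrier (presented_group R)" for x
    using that by (auto simp: car one presented_group_mult)
qed

datatype bs_gen = Gen_a | Gen_b | Gen_c

definition bs_relations :: "nat \<Rightarrow> nat \<Rightarrow> (bs_gen gword \<times> bs_gen gword) set" where
  "bs_relations m n =
     {([(Gen_a, True), (Gen_b, True), (Gen_a, False)], replicate m (Gen_b, True)),
      ([(Gen_a, True), (Gen_c, True), (Gen_a, False)], replicate n (Gen_c, True))}"

definition BS :: "nat \<Rightarrow> nat \<Rightarrow> bs_gen gword set monoid" where
  "BS m n = presented_group (bs_relations m n)"

definition BS_gen :: "nat \<Rightarrow> nat \<Rightarrow> bs_gen \<Rightarrow> bs_gen gword set" where
  "BS_gen m n x = word_class (bs_relations m n) [(x, True)]"

text \<open>At the endpoints of \<open>[0,1]\<close> the derivatives are one-sided.\<close>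

definition C1_on_unit_interval :: "(real \<Rightarrow> real) \<Rightarrow> bool" where
  "C1_on_unit_interval f \<longleftrightarrow>
     (\<exists>f'. (\<forall>x\<in>{0..1}. (f has_real_derivative f' x) (at x within {0..1})) \<and>
           continuous_on {0..1} f')"

text \<open>
  Elements of \<open>BijGroup {0..1}\<close> are functions that are \<open>undefined\<close> outside \<open>[0,1]\<close>,
  and \<open>f \<otimes> g\<close> is \<open>f \<circ> g\<close> on \<open>[0,1]\<close>.
\<close>

definition Diff1_plus :: "(real \<Rightarrow> real) monoid" where
  "Diff1_plus = (BijGroup {0..1})
     \<lparr>carrier := {f \<in> Bij {0..1}. C1_on_unit_interval f \<and>
        C1_on_unit_interval (inv_into {0..1} f) \<and> strict_mono_on {0..1} f}\<rparr>"

lemma C1_on_unit_interval_cong: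
  assumes "\<And>x. x \<in> {0..1} \<Longrightarrow> f x = g x"
  shows "C1_on_unit_interval f \<longleftrightarrow> C1_on_unit_interval g"
proof -
  have "(f has_real_derivative d) (at x within {0..1}) \<longleftrightarrow>
        (g has_real_derivative d) (at x within {0..1})" if "x \<in> {0..1}" for x d
    using that assms by (intro has_field_derivative_cong_eventually)
      (auto simp: eventually_at_filter)
  then show ?thesis unfolding C1_on_unit_interval_def by simp
qed

lemma C1_on_unit_interval_compose:
  assumes f: "C1_on_unit_interval f" and g: "C1_on_unit_interval g"
    and im: "g ` {0..1} \<subseteq> {0..1}"
  shows "C1_on_unit_interval (compose {0..1} f g)"
proof -
  obtain f' where f': "\<And>x. x \<in> {0..1} \<Longrightarrow> (f has_real_derivative f' x) (at x within {0..1})"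
    "continuous_on {0..1} f'" using f unfolding C1_on_unit_interval_def by blast
  obtain g' where g': "\<And>x. x \<in> {0..1} \<Longrightarrow> (g has_real_derivative g' x) (at x within {0..1})"
    "continuous_on {0..1} g'" using g unfolding C1_on_unit_interval_def by blast
  have cg: "continuous_on {0..1} g"
    by (rule DERIV_continuous_on[OF g'(1)])
  have fg: "continuous_on {0..1} (\<lambda>x. f' (g x))"
    by (rule continuous_on_compose2[OF f'(2) cg im])
  have "continuous_on {0..1} (\<lambda>x. f' (g x) * g' x)"
    by (rule continuous_on_mult[OF fg g'(2)])
  moreover have "(f \<circ> g has_real_derivative f' (g x) * g' x) (at x within {0..1})"
    if "x \<in> {0..1}" for x
  proof (rule DERIV_image_chain)
    have "g x \<in> {0..1}" using im that by blast
    then show "(f has_real_derivative f' (g x)) (at (g x) within g ` {0..1})"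
      by (rule DERIV_subset[OF f'(1) im])
    show "(g has_real_derivative g' x) (at x within {0..1})"
      by (rule g'(1)[OF that])
  qed
  ultimately have fog: "C1_on_unit_interval (f \<circ> g)"
    unfolding C1_on_unit_interval_def by (intro exI[of _ "\<lambda>x. f' (g x) * g' x"] conjI ballI)
  have "compose {0..1} f g x = (f \<circ> g) x" if "x \<in> {0..1}" for x
    using that by (simp only: compose_eq comp_apply)
  then show ?thesis
    by (rule iffD2[OF C1_on_unit_interval_cong fog])
qed

lemma subgroup_Diff1_plus: "subgroup (carrier Diff1_plus) (BijGroup {0..1})"
proof (rule group.subgroupI[OF group_BijGroup])
  let ?I = "{0..1::real}"
  have C1_id: "C1_on_unit_interval (\<lambda>x\<in>?I. x)"
  proof (subst C1_on_unit_interval_cong[of _ "\<lambda>x. x"])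
    show "C1_on_unit_interval (\<lambda>x. x)"
      unfolding C1_on_unit_interval_def by (intro exI[of _ "\<lambda>_. 1"]) (auto intro!: derivative_eq_intros)
  qed simp
  have inv_id: "inv_into ?I (\<lambda>x\<in>?I. x) y = (\<lambda>x\<in>?I. x) y" if "y \<in> ?I" for y
    using that inv_into_f_f[of "\<lambda>x\<in>?I. x" ?I y] by (simp add: inj_on_def)
  have "C1_on_unit_interval (inv_into ?I (\<lambda>x\<in>?I. x))"
    using C1_id C1_on_unit_interval_cong[of "inv_into ?I (\<lambda>x\<in>?I. x)" "\<lambda>x\<in>?I. x", OF inv_id] by blast
  then have "(\<lambda>x\<in>?I. x) \<in> carrier Diff1_plus"
    using C1_id id_Bij[of ?I] by (simp add: Diff1_plus_def strict_mono_on_def)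
  then show "carrier Diff1_plus \<noteq> {}" by blast
  show "carrier Diff1_plus \<subseteq> carrier (BijGroup ?I)"
    by (auto simp: Diff1_plus_def BijGroup_def)
  fix f assume f: "f \<in> carrier Diff1_plus"
  then have fB: "f \<in> Bij ?I" and fbij: "bij_betw f ?I ?I" and f1: "C1_on_unit_interval f"
    and f2: "C1_on_unit_interval (inv_into ?I f)" and f3: "strict_mono_on ?I f"
    by (auto simp: Diff1_plus_def Bij_def)
  let ?r = "\<lambda>x\<in>?I. inv_into ?I f x"
  have rB: "?r \<in> Bij ?I" by (rule restrict_inv_into_Bij[OF fB])
  have inv: "inv\<^bsub>BijGroup ?I\<^esub> f = ?r"
    by (rule group.inv_equality[OF group_BijGroup])
      (use fB rB in \<open>auto simp: BijGroup_def Bij_compose_restrict_eq\<close>)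
  have ir: "inv_into ?I ?r y = f y" if "y \<in> ?I" for y
  proof (rule inv_into_f_eq)
    show "inj_on ?r ?I" using rB by (auto simp: Bij_def bij_betw_def)
    show fy: "f y \<in> ?I" using fbij that by (rule bij_betwE[THEN bspec])
    show "?r (f y) = y" using fy that fbij by (simp only: restrict_apply if_True bij_betw_inv_into_left)
  qed
  have "strict_mono_on ?I ?r"
  proof (rule strict_mono_onI)
    fix x y assume xy: "x \<in> ?I" "y \<in> ?I" "x < y"
    let ?a = "inv_into ?I f x" and ?b = "inv_into ?I f y"
    have ab: "?a \<in> ?I" "?b \<in> ?I" "f ?a = x" "f ?b = y"
      using fB fbij xy(1,2) by (simp_all only: Bij_inv_into_mem bij_betw_inv_into_right)
    have "\<not> ?b \<le> ?a"
      using strict_mono_on_leD[OF f3 ab(2,1)] ab(3,4) xy(3) by linarith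
    then show "?r x < ?r y" using xy by simp
  qed
  moreover have "C1_on_unit_interval ?r"
    using f2 by (subst C1_on_unit_interval_cong[of _ "inv_into ?I f"]) auto
  moreover have "C1_on_unit_interval (inv_into ?I ?r)"
    using C1_on_unit_interval_cong[of "inv_into ?I ?r" f, OF ir] f1 by blast
  ultimately show "inv\<^bsub>BijGroup ?I\<^esub> f \<in> carrier Diff1_plus"
    using rB by (simp add: inv Diff1_plus_def)
  fix g assume g: "g \<in> carrier Diff1_plus"
  then have gB: "g \<in> Bij ?I" and gbij: "bij_betw g ?I ?I" and g1: "C1_on_unit_interval g"
    and g2: "C1_on_unit_interval (inv_into ?I g)" and g3: "strict_mono_on ?I g"
    by (auto simp: Diff1_plus_def Bij_def)
  have cB: "compose ?I f g \<in> Bij ?I" by (rule compose_Bij[OF fB gB])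
  have ic: "inv_into ?I (compose ?I f g) y = compose ?I (inv_into ?I g) (inv_into ?I f) y"
    if y: "y \<in> ?I" for y
  proof (rule inv_into_f_eq)
    have a: "inv_into ?I f y \<in> ?I" by (rule Bij_inv_into_mem[OF fB y])
    have b: "inv_into ?I g (inv_into ?I f y) \<in> ?I" by (rule Bij_inv_into_mem[OF gB a])
    show "inj_on (compose ?I f g) ?I" using cB by (auto simp: Bij_def bij_betw_def)
    show "compose ?I (inv_into ?I g) (inv_into ?I f) y \<in> ?I"
      using b y by (simp only: compose_eq)
    show "compose ?I f g (compose ?I (inv_into ?I g) (inv_into ?I f) y) = y"
      using a b y fbij gbij by (simp only: compose_eq bij_betw_inv_into_right)
  qed
  have "C1_on_unit_interval (compose ?I (inv_into ?I g) (inv_into ?I f))"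
    using Bij_inv_into_mem[OF fB] by (intro C1_on_unit_interval_compose g2 f2) blast
  then have "C1_on_unit_interval (inv_into ?I (compose ?I f g))"
    using C1_on_unit_interval_cong[of "inv_into ?I (compose ?I f g)"
        "compose ?I (inv_into ?I g) (inv_into ?I f)", OF ic] by blast
  moreover have "C1_on_unit_interval (compose ?I f g)"
    using gbij by (intro C1_on_unit_interval_compose f1 g1) (simp add: bij_betw_def)
  moreover have "strict_mono_on ?I (compose ?I f g)"
  proof (rule strict_mono_onI)
    fix x y assume xy: "x \<in> ?I" "y \<in> ?I" "x < y"
    have "g x \<in> ?I" "g y \<in> ?I" using gbij xy by (auto simp: bij_betw_def)
    then have "f (g x) < f (g y)"
      using xy by (intro strict_mono_onD[OF f3] strict_mono_onD[OF g3])
    then show "compose ?I f g x < compose ?I f g y"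
      using xy(1,2) by (simp only: compose_eq)
  qed
  ultimately show "f \<otimes>\<^bsub>BijGroup ?I\<^esub> g \<in> carrier Diff1_plus"
    using fB gB cB by (simp add: BijGroup_def Diff1_plus_def)
qed

lemma group_Diff1_plus: "group Diff1_plus"
proof -
  have "Diff1_plus = (BijGroup {0..1})\<lparr>carrier := carrier Diff1_plus\<rparr>"
    by (simp add: Diff1_plus_def)
  then show ?thesis
    using group.subgroup_imp_group[OF group_BijGroup subgroup_Diff1_plus] by simp
qed

definition diffeo_support :: "(real \<Rightarrow> real) \<Rightarrow> real set" where
  "diffeo_support f = closure {x \<in> {0..1}. f x \<noteq> x}"

end

theory Submission
  imports Defs
begin

text \<open>
  Let \<open>f g f\<^sup>-\<^sup>1 = g\<^sup>m\<close> and let \<open>(p, q)\<close> be a component of the set moved by \<open>g\<close>, say with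
  \<open>g x > x\<close> there. Since \<open>g\<close> has derivative 1 and \<open>f\<close> almost constant derivative near an endpoint, the
  \<open>m\<^sup>r\<close> intervals \<open>f\<^sup>-\<^sup>r g\<^sup>j [y, g y]\<close>, \<open>M m\<^sup>r \<le> j < (M + 1) m\<^sup>r\<close>, have comparable lengths up to a
  factor that is subexponential in \<open>r\<close>. This forces \<open>f\<close> to preserve \<open>(p, q)\<close>, and it forces every
  fixed point \<open>s\<close> of \<open>f\<close> in \<open>(p, q)\<close> to satisfy \<open>f' s = m\<close>: the interval \<open>f\<^sup>-\<^sup>r [s, g s]\<close> has length
  \<open>m\<^sup>-\<^sup>r\<close> up to such a factor. Such a fixed point exists because \<open>f\<close> expands along the orbits of \<open>g\<close>.

  If a component of \<open>g\<close> met one of \<open>h\<close>, then either both would contain a common fixed point of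
  \<open>f\<close>, with derivative both \<open>m\<close> and \<open>n\<close>, or their intersection would be bounded by two expanding fixed
  points of \<open>f\<close>, between which there is a further fixed point.
\<close>

section \<open>Comparing lengths in a self-similar tiling\<close>

text \<open>
  The map \<open>g\<close> shifts a tile \<open>(r, j)\<close> of length \<open>L r j\<close> by \<open>m\<^sup>r\<close>, and \<open>f\<close> carries tile \<open>(r + 1, j)\<close>
  to tile \<open>(r, j)\<close>. Moving \<open>j\<close> to the first of the \<open>m\<close> blocks of its level costs at most \<open>m - 1\<close>
  applications of \<open>g\<close>, so each level costs the distortion of at most \<open>2 m\<close> maps in total.
\<close>

lemma tile_comparison:
  fixes L :: "nat \<Rightarrow> nat \<Rightarrow> real" and m M :: nat and \<sigma> \<kappa> :: real
  assumes \<sigma>: "\<sigma> \<ge> 1" and \<kappa>: "\<kappa> > 0" and m: "m \<ge> 1"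
    and pos: "\<And>r j. L r j > 0"
    and f1: "\<And>r j. j \<ge> M * m ^ Suc r \<Longrightarrow> L r j \<le> \<kappa> * \<sigma> * L (Suc r) j"
    and f2: "\<And>r j. j \<ge> M * m ^ Suc r \<Longrightarrow> \<kappa> * L (Suc r) j \<le> \<sigma> * L r j"
    and g1: "\<And>r j. j \<ge> M * m ^ r \<Longrightarrow> L r (j + m ^ r) \<le> \<sigma> * L r j"
    and g2: "\<And>r j. j \<ge> M * m ^ r \<Longrightarrow> L r j \<le> \<sigma> * L r (j + m ^ r)"
  shows "j div m ^ r = j' div m ^ r \<Longrightarrow> M \<le> j div m ^ r \<Longrightarrow> L r j \<le> (\<sigma> ^ (2 * m)) ^ r * L r j'"
proof (induction r arbitrary: j j')
  case 0
  then show ?case by simp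
next
  case (Suc r)
  define k where "k = j div m ^ Suc r"
  have mr: "m ^ r > 0" using m by simp
  have Mk: "M \<le> k" using Suc.prems by (simp add: k_def)
  have shift1: "L r (a + i * m ^ r) \<le> \<sigma> ^ i * L r a" and shift2: "L r a \<le> \<sigma> ^ i * L r (a + i * m ^ r)"
    if a: "a \<ge> M * m ^ r" for a i
  proof (induction i)
    case (Suc i)
    have ge: "a + i * m ^ r \<ge> M * m ^ r" using a by simp
    have e: "a + Suc i * m ^ r = a + i * m ^ r + m ^ r" by simp
    {
      case 1
      have "L r (a + Suc i * m ^ r) \<le> \<sigma> * L r (a + i * m ^ r)" unfolding e by (rule g1[OF ge])
      also have "\<dots> \<le> \<sigma> * (\<sigma> ^ i * L r a)" using Suc.IH(1) \<sigma> by (intro mult_left_mono) auto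
      finally show ?case by simp
    next
      case 2
      have "L r a \<le> \<sigma> ^ i * L r (a + i * m ^ r)" by (rule Suc.IH(2))
      also have "\<dots> \<le> \<sigma> ^ i * (\<sigma> * L r (a + Suc i * m ^ r))"
        unfolding e by (intro mult_left_mono g2[OF ge]) (use \<sigma> in auto)
      finally show ?case by (simp add: mult_ac)
    }
  qed simp_all
  \<comment> \<open>Every index in block \<open>k\<close> of level \<open>Suc r\<close> is brought
    back to the first of the \<open>m\<close> blocks of level \<open>r\<close> inside it. That block
    has number \<open>k * m \<ge> M\<close>, so the induction hypothesis applies to it.\<close>
  have reduce: "\<exists>j0 i. i < m \<and> l = j0 + i * m ^ r \<and> j0 div m ^ r = k * m \<and> j0 \<ge> M * m ^ r
      \<and> l \<ge> M * m ^ Suc r" if "l div m ^ Suc r = k" for l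
  proof -
    define i where "i = (l div m ^ r) mod m"
    define j0 where "j0 = k * m * m ^ r + l mod m ^ r"
    have kl: "l div m ^ r div m = k" using that unfolding power_Suc2 div_mult2_eq .
    have "l = l div m ^ r * m ^ r + l mod m ^ r" by (simp only: div_mult_mod_eq)
    also have "l div m ^ r = k * m + i" unfolding i_def kl[symmetric] by simp
    finally have l: "l = j0 + i * m ^ r" by (simp add: j0_def algebra_simps)
    have d: "j0 div m ^ r = k * m" unfolding j0_def using mr by simp
    have "M * m ^ Suc r \<le> k * m ^ Suc r" using Mk by simp
    also have "\<dots> \<le> j0" by (simp add: j0_def algebra_simps)
    finally have a: "M * m ^ Suc r \<le> j0" .
    have "M * m ^ r \<le> M * m ^ Suc r" using m by simp
    with a have "M * m ^ r \<le> j0" by linarith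
    moreover have "i < m" using m by (simp add: i_def)
    ultimately show ?thesis using l d a by (intro exI[of _ j0] exI[of _ i]) auto
  qed
  obtain j0 i where j0: "i < m" "j = j0 + i * m ^ r" "j0 div m ^ r = k * m" "j0 \<ge> M * m ^ r"
    "j \<ge> M * m ^ Suc r" using reduce[of j] by (auto simp: k_def)
  obtain j0' i' where j0': "i' < m" "j' = j0' + i' * m ^ r" "j0' div m ^ r = k * m" "j0' \<ge> M * m ^ r"
    "j' \<ge> M * m ^ Suc r" using reduce[of j'] Suc.prems by (auto simp: k_def)
  have km: "M \<le> k * m" using Mk m by (metis le_trans mult.right_neutral mult_le_mono2)
  have pw: "\<sigma> ^ i \<le> \<sigma> ^ (m - 1)" "\<sigma> ^ i' \<le> \<sigma> ^ (m - 1)"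
    using \<sigma> j0(1) j0'(1) by (auto intro!: power_increasing)
  have "\<kappa> * L (Suc r) j \<le> \<sigma> * L r j" by (rule f2[OF j0(5)])
  also have "L r j \<le> \<sigma> ^ (m - 1) * L r j0"
    using shift1[OF j0(4), of i] pw(1) pos[of r j0] unfolding j0(2)
    by (meson less_imp_le mult_right_mono order_trans)
  also have "L r j0 \<le> (\<sigma> ^ (2 * m)) ^ r * L r j0'"
    using Suc.IH[of j0 j0'] j0(3) j0'(3) km by simp
  also have "L r j0' \<le> \<sigma> ^ (m - 1) * L r j'"
    using shift2[OF j0'(4), of i'] pw(2) pos[of r j'] unfolding j0'(2)
    by (meson less_imp_le mult_right_mono order_trans)
  also have "L r j' \<le> \<kappa> * \<sigma> * L (Suc r) j'" by (rule f1[OF j0'(5)])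
  finally have "\<kappa> * L (Suc r) j \<le> \<sigma> * (\<sigma> ^ (m - 1) * ((\<sigma> ^ (2 * m)) ^ r * (\<sigma> ^ (m - 1) *
      (\<kappa> * \<sigma> * L (Suc r) j'))))"
    using \<sigma> by simp
  also have "\<dots> = \<kappa> * ((\<sigma> * \<sigma> ^ (m - 1)) * (\<sigma> * \<sigma> ^ (m - 1)) * (\<sigma> ^ (2 * m)) ^ r * L (Suc r) j')"
    by (simp add: mult_ac)
  also have "\<sigma> * \<sigma> ^ (m - 1) = \<sigma> ^ m" using m by (metis Suc_pred' power_Suc zero_less_one less_le_trans)
  also have "\<sigma> ^ m * \<sigma> ^ m = \<sigma> ^ (2 * m)" by (simp add: power_add[symmetric] mult_2)
  finally show ?case using \<kappa> by simp
qed

text \<open>All tiles of block \<open>M\<close> at level \<open>r\<close> have index quotient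
  \<open>M\<close>, so \<open>tile_comparison\<close> bounds each against the first one in both
  directions. Summing \<open>m ^ r\<close> such bounds keeps the same distortion factor.\<close>

lemma tile_sum:
  fixes L :: "nat \<Rightarrow> nat \<Rightarrow> real" and m M r :: nat and \<sigma> \<kappa> :: real
  assumes "\<sigma> \<ge> 1" "\<kappa> > 0" and m: "m \<ge> 1"
    and "\<And>r j. L r j > 0"
    and "\<And>r j. j \<ge> M * m ^ Suc r \<Longrightarrow> L r j \<le> \<kappa> * \<sigma> * L (Suc r) j"
    and "\<And>r j. j \<ge> M * m ^ Suc r \<Longrightarrow> \<kappa> * L (Suc r) j \<le> \<sigma> * L r j"
    and "\<And>r j. j \<ge> M * m ^ r \<Longrightarrow> L r (j + m ^ r) \<le> \<sigma> * L r j"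
    and "\<And>r j. j \<ge> M * m ^ r \<Longrightarrow> L r j \<le> \<sigma> * L r (j + m ^ r)"
  defines "S \<equiv> \<Sum>j<m ^ r. L r (M * m ^ r + j)"
  shows "real (m ^ r) * L r (M * m ^ r) \<le> (\<sigma> ^ (2 * m)) ^ r * S"
    and "S \<le> (\<sigma> ^ (2 * m)) ^ r * (real (m ^ r) * L r (M * m ^ r))"
proof -
  have mr: "m ^ r > 0" using m by simp
  have d: "(M * m ^ r + j) div m ^ r = M" if "j < m ^ r" for j using that mr by simp
  note * = tile_comparison[OF assms(1-8), where r = r]
  have "real (m ^ r) * L r (M * m ^ r) = (\<Sum>j<m ^ r. L r (M * m ^ r))" by simp
  also have "\<dots> \<le> (\<Sum>j<m ^ r. (\<sigma> ^ (2 * m)) ^ r * L r (M * m ^ r + j))"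
    by (intro sum_mono *) (use d mr in auto)
  finally show "real (m ^ r) * L r (M * m ^ r) \<le> (\<sigma> ^ (2 * m)) ^ r * S"
    by (simp add: S_def sum_distrib_left)
  have "S \<le> (\<Sum>j<m ^ r. (\<sigma> ^ (2 * m)) ^ r * L r (M * m ^ r))"
    unfolding S_def by (intro sum_mono *) (use d mr in auto)
  then show "S \<le> (\<sigma> ^ (2 * m)) ^ r * (real (m ^ r) * L r (M * m ^ r))"
    by (simp add: mult_ac)
qed

subsection \<open>Diffeomorphisms of the unit interval\<close>

text \<open>\<open>F\<close> is the inverse of \<open>f\<close> and \<open>f'\<close> its derivative, one-sided at the endpoints.\<close>

locale interval_diffeo =
  fixes f F f' :: "real \<Rightarrow> real"
  assumes maps: "x \<in> {0..1} \<Longrightarrow> f x \<in> {0..1}"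
    and inv_maps: "x \<in> {0..1} \<Longrightarrow> F x \<in> {0..1}"
    and right_inv: "x \<in> {0..1} \<Longrightarrow> f (F x) = x"
    and left_inv: "x \<in> {0..1} \<Longrightarrow> F (f x) = x"
    and mono: "x \<in> {0..1} \<Longrightarrow> y \<in> {0..1} \<Longrightarrow> x < y \<Longrightarrow> f x < f y"
    and deriv: "x \<in> {0..1} \<Longrightarrow> (f has_real_derivative f' x) (at x within {0..1})"
    and cont_deriv: "continuous_on {0..1} f'"
    and deriv_pos: "x \<in> {0..1} \<Longrightarrow> f' x > 0"
begin

lemma less_iff: "x \<in> {0..1} \<Longrightarrow> y \<in> {0..1} \<Longrightarrow> f x < f y \<longleftrightarrow> x < y"
  using mono[of x y] mono[of y x] by (cases x y rule: linorder_cases) auto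

lemma le_iff: "x \<in> {0..1} \<Longrightarrow> y \<in> {0..1} \<Longrightarrow> f x \<le> f y \<longleftrightarrow> x \<le> y"
  using less_iff[of y x] by (simp add: linorder_not_less[symmetric])

lemma eq_iff: "x \<in> {0..1} \<Longrightarrow> y \<in> {0..1} \<Longrightarrow> f x = f y \<longleftrightarrow> x = y"
  using left_inv by metis

lemma inv_less_iff: "x \<in> {0..1} \<Longrightarrow> y \<in> {0..1} \<Longrightarrow> F x < F y \<longleftrightarrow> x < y"
  using less_iff[of "F x" "F y"] inv_maps right_inv by metis

lemma inv_fixed_iff: "x \<in> {0..1} \<Longrightarrow> F x = x \<longleftrightarrow> f x = x"
  using left_inv right_inv by metis

lemma cont: "continuous_on {0..1} f"
  by (rule DERIV_continuous_on[OF deriv])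

lemma fixes_0: "f 0 = 0"
  using le_iff[of 0 "F 0"] right_inv[of 0] inv_maps[of 0] maps[of 0] by auto

lemma fixes_1: "f 1 = 1"
  using le_iff[of "F 1" 1] right_inv[of 1] inv_maps[of 1] maps[of 1] by auto

lemma pow_maps: "x \<in> {0..1} \<Longrightarrow> (f ^^ k) x \<in> {0..1}"
  by (induction k) (use maps in auto)

lemma inv_pow_maps: "x \<in> {0..1} \<Longrightarrow> (F ^^ k) x \<in> {0..1}"
  by (induction k) (use inv_maps in auto)

lemma pow_less_iff: "x \<in> {0..1} \<Longrightarrow> y \<in> {0..1} \<Longrightarrow> (f ^^ k) x < (f ^^ k) y \<longleftrightarrow> x < y"
  by (induction k) (use less_iff pow_maps in auto)

lemma pow_le_iff: "x \<in> {0..1} \<Longrightarrow> y \<in> {0..1} \<Longrightarrow> (f ^^ k) x \<le> (f ^^ k) y \<longleftrightarrow> x \<le> y"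
  using pow_less_iff[of y x] by (simp add: linorder_not_less[symmetric])

lemma inv_pow_less_iff: "x \<in> {0..1} \<Longrightarrow> y \<in> {0..1} \<Longrightarrow> (F ^^ k) x < (F ^^ k) y \<longleftrightarrow> x < y"
  by (induction k) (use inv_less_iff inv_pow_maps in auto)

lemma inv_pow_le_iff: "x \<in> {0..1} \<Longrightarrow> y \<in> {0..1} \<Longrightarrow> (F ^^ k) x \<le> (F ^^ k) y \<longleftrightarrow> x \<le> y"
  using inv_pow_less_iff[of y x] by (simp add: linorder_not_less[symmetric])

lemma pow_inv_pow: "x \<in> {0..1} \<Longrightarrow> (f ^^ k) ((F ^^ k) x) = x"
proof (induction k)
  case (Suc k)
  have "(f ^^ Suc k) ((F ^^ Suc k) x) = (f ^^ k) (f (F ((F ^^ k) x)))"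
    by (simp add: funpow_swap1)
  then show ?case using right_inv[OF inv_pow_maps[OF Suc.prems]] Suc by simp
qed simp

lemma inv_pow_pow: "x \<in> {0..1} \<Longrightarrow> (F ^^ k) ((f ^^ k) x) = x"
proof (induction k)
  case (Suc k)
  have "(F ^^ Suc k) ((f ^^ Suc k) x) = (F ^^ k) (F (f ((f ^^ k) x)))"
    by (simp add: funpow_swap1)
  then show ?case using left_inv[OF pow_maps[OF Suc.prems]] Suc by simp
qed simp

lemma pow_fixed: "f x = x \<Longrightarrow> (f ^^ k) x = x"
  by (induction k) auto

lemma inv_pow_fixed: "F x = x \<Longrightarrow> (F ^^ k) x = x"
  by (induction k) auto

lemma mvt:
  assumes "0 \<le> u" "u < v" "v \<le> 1"
  shows "\<exists>\<xi>. u < \<xi> \<and> \<xi> < v \<and> f v - f u = f' \<xi> * (v - u)"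
proof -
  have "\<exists>\<xi>\<in>{u<..<v}. f v - f u = (\<lambda>h. h * f' \<xi>) (v - u)"
  proof (rule mvt_simple[OF assms(2), of f "\<lambda>\<xi> h. h * f' \<xi>"])
    fix x assume "u \<le> x" "x \<le> v"
    then have "(f has_real_derivative f' x) (at x within {u..v})"
      using assms by (intro DERIV_subset[OF deriv]) auto
    then show "(f has_derivative (\<lambda>h. h * f' x)) (at x within {u..v})"
      by (simp add: has_field_derivative_def mult.commute[of _ "f' x"] lambda_one)
  qed
  then show ?thesis by (auto simp: mult.commute)
qed

lemma pow_deriv_fixed:
  assumes "x \<in> {0..1}" "f x = x"
  shows "((f ^^ k) has_real_derivative f' x ^ k) (at x within {0..1})"
proof (induction k)
  case 0
  show ?case using DERIV_ident[of "at x within {0..1}"] by (simp add: id_def)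
next
  case (Suc k)
  have "(f \<circ> (f ^^ k) has_real_derivative f' x * f' x ^ k) (at x within {0..1})"
  proof (rule DERIV_image_chain)
    show "(f has_real_derivative f' x) (at ((f ^^ k) x) within (f ^^ k) ` {0..1})"
      unfolding pow_fixed[OF assms(2)] using pow_maps by (intro DERIV_subset[OF deriv[OF assms(1)]]) blast
  qed (rule Suc)
  then show ?case by (simp add: comp_def)
qed

end

section \<open>Auxiliary facts from real analysis\<close>

lemma has_real_derivative_unique_unit_interval:
  fixes x :: real
  assumes "x \<in> {0..1}" "(f has_real_derivative c) (at x within {0..1})"
    "(f has_real_derivative d) (at x within {0..1})"
  shows "c = d"
proof -
  have "at x within {0..1::real} \<noteq> bot"
    using assms(1) by (simp add: trivial_limit_within)
  then show ?thesis
    using tendsto_unique assms(2,3) unfolding has_field_derivative_iff by blast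
qed

text \<open>A limit above 1 would force geometric growth at a rate \<open>\<rho>\<^sub>2\<close>,
  against the bound for a smaller rate \<open>\<rho>\<^sub>1 > 1\<close>. Applied to a normalised
  length and to its reciprocal, this determines a derivative exactly.\<close>

lemma ratio_limit_le_1:
  fixes a :: "nat \<Rightarrow> real"
  assumes pos: "\<And>r. a r > 0" and lim: "(\<lambda>r. a (Suc r) / a r) \<longlonglongrightarrow> \<theta>"
    and sub: "\<And>\<rho>. \<rho> > 1 \<Longrightarrow> \<exists>C. \<forall>r. a r \<le> C * \<rho> ^ r"
  shows "\<theta> \<le> 1"
proof (rule ccontr)
  assume "\<not> \<theta> \<le> 1"
  then obtain \<rho>\<^sub>1 where \<rho>1: "1 < \<rho>\<^sub>1" "\<rho>\<^sub>1 < \<theta>" using dense[of 1 \<theta>] by auto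
  then obtain \<rho>\<^sub>2 where \<rho>2: "\<rho>\<^sub>1 < \<rho>\<^sub>2" "\<rho>\<^sub>2 < \<theta>" using dense by blast
  obtain C where C: "\<And>r. a r \<le> C * \<rho>\<^sub>1 ^ r" using sub[OF \<rho>1(1)] by blast
  have "\<forall>\<^sub>F r in sequentially. \<rho>\<^sub>2 < a (Suc r) / a r" by (rule order_tendstoD(1)[OF lim \<rho>2(2)])
  then obtain N where N: "\<And>r. r \<ge> N \<Longrightarrow> \<rho>\<^sub>2 < a (Suc r) / a r"
    unfolding eventually_sequentially by blast
  have grow: "\<rho>\<^sub>2 ^ k * a N \<le> a (N + k)" for k
  proof (induction k)
    case (Suc k)
    have "\<rho>\<^sub>2 * a (N + k) \<le> a (N + Suc k)"
      using N[of "N + k"] pos[of "N + k"] by (simp add: field_simps)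
    moreover have "\<rho>\<^sub>2 * (\<rho>\<^sub>2 ^ k * a N) \<le> \<rho>\<^sub>2 * a (N + k)"
      using Suc \<rho>1 \<rho>2 by (intro mult_left_mono) auto
    ultimately show ?case by (simp add: mult_ac)
  qed simp
  have "1 < \<rho>\<^sub>2 / \<rho>\<^sub>1" using \<rho>1 \<rho>2 by simp
  then obtain k where k: "C * \<rho>\<^sub>1 ^ N / a N < (\<rho>\<^sub>2 / \<rho>\<^sub>1) ^ k" using real_arch_pow by blast
  have "\<rho>\<^sub>2 ^ k * a N \<le> C * \<rho>\<^sub>1 ^ N * \<rho>\<^sub>1 ^ k"
    using grow[of k] C[of "N + k"] by (simp add: power_add mult_ac)
  then have "(\<rho>\<^sub>2 / \<rho>\<^sub>1) ^ k \<le> C * \<rho>\<^sub>1 ^ N / a N"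
    using pos[of N] \<rho>1 by (simp add: field_simps)
  with k show False by simp
qed

text \<open>The bounds use \<open>min\<close> and \<open>max\<close> because a point pushed down and
  a point pushed up may come in either order.\<close>

lemma exists_fixed_point_between:
  fixes f :: "real \<Rightarrow> real"
  assumes "continuous_on {min u v..max u v} f" "f u \<le> u" "v \<le> f v"
  shows "\<exists>w. min u v \<le> w \<and> w \<le> max u v \<and> f w = w"
proof -
  have c: "continuous_on {min u v..max u v} (\<lambda>x. f x - x)"
    by (intro continuous_intros assms)
  show ?thesis
  proof (cases "u \<le> v")
    case True
    then show ?thesis using IVT'[of "\<lambda>x. f x - x" u 0 v] c assms(2,3) by force
  next
    case False
    then show ?thesis using IVT2'[of "\<lambda>x. f x - x" u 0 v] c assms(2,3) by force
  qed
qed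

section \<open>Distortion and fixed points of a single diffeomorphism\<close>

context interval_diffeo
begin

text \<open>Continuity of \<open>f'\<close> in multiplicative form: positivity of
  \<open>f' x0\<close> turns an additive tolerance into a factor.\<close>

lemma deriv_near:
  assumes "x0 \<in> {0..1}" "\<sigma> > 1"
  shows "\<exists>\<delta>>0. \<forall>x\<in>{0..1}. \<bar>x - x0\<bar> < \<delta> \<longrightarrow> f' x0 \<le> \<sigma> * f' x \<and> f' x \<le> f' x0 * \<sigma>"
proof -
  \<comment> \<open>Tailored to the lower bound \<open>f' x0 / \<sigma>\<close>; the upper bound
    follows because \<open>1 - 1 / \<sigma> \<le> \<sigma> - 1\<close>.\<close>
  define e where "e = f' x0 * (1 - 1 / \<sigma>)"
  have pos: "f' x0 > 0" by (rule deriv_pos[OF assms(1)])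
  have "e > 0" using pos assms(2) by (simp add: e_def)
  then obtain \<delta> where \<delta>: "\<delta> > 0" "\<And>x. x \<in> {0..1} \<Longrightarrow> \<bar>x - x0\<bar> < \<delta> \<Longrightarrow> \<bar>f' x - f' x0\<bar> < e"
    using cont_deriv assms(1) unfolding continuous_on_iff dist_real_def by meson
  have "f' x0 \<le> \<sigma> * f' x \<and> f' x \<le> f' x0 * \<sigma>" if "x \<in> {0..1}" "\<bar>x - x0\<bar> < \<delta>" for x
  proof
    have d: "\<bar>f' x - f' x0\<bar> < e" by (rule \<delta>(2)[OF that])
    then have "f' x0 / \<sigma> < f' x" by (simp add: e_def algebra_simps)
    then show "f' x0 \<le> \<sigma> * f' x" using assms(2) by (simp add: field_simps)
    have "e \<le> f' x0 * (\<sigma> - 1)"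
    proof -
      have "1 - 1 / \<sigma> \<le> \<sigma> - 1"
        using assms(2) sum_squares_ge_zero[of "\<sigma> - 1" 0] by (simp add: field_simps power2_eq_square)
      then show ?thesis unfolding e_def using pos by simp
    qed
    then show "f' x \<le> f' x0 * \<sigma>" using d by (simp add: algebra_simps)
  qed
  with \<delta>(1) show ?thesis by blast
qed

lemma limit_fixed:
  assumes "x \<in> {0..1}" "(\<lambda>k. (f ^^ k) x) \<longlonglongrightarrow> l"
  shows "l \<in> {0..1}" "f l = l"
proof -
  show l: "l \<in> {0..1}"
    by (rule closed_sequentially[OF _ _ assms(2)]) (use pow_maps[OF assms(1)] in auto)
  have "(\<lambda>k. f ((f ^^ k) x)) \<longlonglongrightarrow> f l"
    by (rule continuous_on_tendsto_compose[OF cont assms(2) l]) (use pow_maps[OF assms(1)] in auto)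
  moreover have "(\<lambda>k. f ((f ^^ k) x)) \<longlonglongrightarrow> l"
    using LIMSEQ_Suc[OF assms(2)] by simp
  ultimately show "f l = l" by (rule LIMSEQ_unique)
qed

text \<open>By compactness \<open>f'\<close> has a positive minimum and a maximum, and the mean
  value theorem multiplies these along the iteration.\<close>

lemma pow_bilipschitz:
  "\<exists>c>0. \<exists>C>0. \<forall>u v. 0 \<le> u \<longrightarrow> u < v \<longrightarrow> v \<le> 1 \<longrightarrow>
     c * (v - u) \<le> (f ^^ k) v - (f ^^ k) u \<and> (f ^^ k) v - (f ^^ k) u \<le> C * (v - u)"
proof (induction k)
  case 0
  show ?case by (rule exI[of _ 1], rule conjI[rotated], rule exI[of _ 1]) auto
next
  case (Suc k)
  then obtain c C where cC: "c > 0" "C > 0"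
    "\<And>u v. 0 \<le> u \<Longrightarrow> u < v \<Longrightarrow> v \<le> 1 \<Longrightarrow> c * (v - u) \<le> (f ^^ k) v - (f ^^ k) u"
    "\<And>u v. 0 \<le> u \<Longrightarrow> u < v \<Longrightarrow> v \<le> 1 \<Longrightarrow> (f ^^ k) v - (f ^^ k) u \<le> C * (v - u)" by metis
  obtain a where a: "a \<in> {0..1}" "\<And>x. x \<in> {0..1} \<Longrightarrow> f' a \<le> f' x"
    using continuous_attains_inf[of "{0..1}" f'] cont_deriv by auto
  obtain b where b: "b \<in> {0..1}" "\<And>x. x \<in> {0..1} \<Longrightarrow> f' x \<le> f' b"
    using continuous_attains_sup[of "{0..1}" f'] cont_deriv by auto
  have ab: "f' a > 0" "f' b > 0" using deriv_pos a b by auto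
  have "f' a * c * (v - u) \<le> (f ^^ Suc k) v - (f ^^ Suc k) u \<and>
        (f ^^ Suc k) v - (f ^^ Suc k) u \<le> f' b * C * (v - u)"
    if uv: "0 \<le> u" "u < v" "v \<le> 1" for u v
  proof -
    have lt: "(f ^^ k) u < (f ^^ k) v" "0 \<le> (f ^^ k) u" "(f ^^ k) v \<le> 1"
      using uv pow_less_iff[of u v k] pow_maps[of u k] pow_maps[of v k] by auto
    obtain \<xi> where \<xi>: "(f ^^ k) u < \<xi>" "\<xi> < (f ^^ k) v"
      "f ((f ^^ k) v) - f ((f ^^ k) u) = f' \<xi> * ((f ^^ k) v - (f ^^ k) u)"
      using mvt[OF lt(2,1,3)] by blast
    have xi: "\<xi> \<in> {0..1}" using \<xi>(1,2) lt by auto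
    have "f' a * (c * (v - u)) \<le> f' \<xi> * ((f ^^ k) v - (f ^^ k) u)"
      using a(2)[OF xi] cC(1,3) uv ab by (intro mult_mono) auto
    moreover have "f' \<xi> * ((f ^^ k) v - (f ^^ k) u) \<le> f' b * (C * (v - u))"
      using b(2)[OF xi] cC(4) uv ab lt by (intro mult_mono) auto
    ultimately show ?thesis using \<xi>(3) by (simp add: mult_ac)
  qed
  then show ?case using ab cC(1,2)
    by (intro exI[of _ "f' a * c"] exI[of _ "f' b * C"] conjI) auto
qed

text \<open>Expansion at the two fixed ends puts the graph above the diagonal just right of
  \<open>u\<close> and below it just left of \<open>v\<close>, so it crosses the diagonal in
  between.\<close>

lemma fixed_point_between_expanding:
  assumes uv: "0 \<le> u" "u < v" "v \<le> 1" and fixed: "f u = u" "f v = v"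
    and exp: "f' u > 1" "f' v > 1"
  shows "\<exists>w. u < w \<and> w < v \<and> f w = w"
proof -
  have near: "\<exists>\<delta>>0. \<forall>x\<in>{0..1}. \<bar>x - x0\<bar> < \<delta> \<longrightarrow> f' x > 1" if x0: "x0 \<in> {0..1}" "f' x0 > 1" for x0
  proof -
    obtain \<delta> where "\<delta> > 0" "\<And>x. x \<in> {0..1} \<Longrightarrow> \<bar>x - x0\<bar> < \<delta> \<Longrightarrow> \<bar>f' x - f' x0\<bar> < f' x0 - 1"
      using cont_deriv x0 unfolding continuous_on_iff dist_real_def by (metis diff_gt_0_iff_gt)
    then show ?thesis by (intro exI[of _ \<delta>]) force
  qed
  obtain \<delta> where \<delta>: "\<delta> > 0" "\<And>x. x \<in> {0..1} \<Longrightarrow> \<bar>x - u\<bar> < \<delta> \<Longrightarrow> f' x > 1"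
    using near[of u] uv exp by auto
  obtain \<epsilon> where \<epsilon>: "\<epsilon> > 0" "\<And>x. x \<in> {0..1} \<Longrightarrow> \<bar>x - v\<bar> < \<epsilon> \<Longrightarrow> f' x > 1"
    using near[of v] uv exp by auto
  define a where "a = min (u + \<delta>) ((u + v) / 2)"
  define b where "b = max (v - \<epsilon>) ((u + v) / 2)"
  have a: "u < a" "a < v" "a \<le> u + \<delta>" and b: "u < b" "b < v" "v - \<epsilon> \<le> b"
    using uv \<delta>(1) \<epsilon>(1) by (auto simp: a_def b_def min_def max_def field_simps)
  obtain \<xi> where \<xi>: "u < \<xi>" "\<xi> < a" "f a - f u = f' \<xi> * (a - u)"
    using mvt[of u a] a uv by auto
  have "f' \<xi> > 1" using \<xi>(1,2) a uv by (intro \<delta>(2)) auto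
  then have "a - u < f' \<xi> * (a - u)" using a(1) by simp
  then have fa: "a \<le> f a" using \<xi>(3) fixed(1) by simp
  obtain \<eta> where \<eta>: "b < \<eta>" "\<eta> < v" "f v - f b = f' \<eta> * (v - b)"
    using mvt[of b v] b uv by auto
  have "f' \<eta> > 1" using \<eta>(1,2) b uv by (intro \<epsilon>(2)) auto
  then have "v - b < f' \<eta> * (v - b)" using b(2) by simp
  then have fb: "f b \<le> b" using \<eta>(3) fixed(2) by simp
  have "continuous_on {min b a..max b a} f"
    by (rule continuous_on_subset[OF cont]) (use a b uv in auto)
  from exists_fixed_point_between[OF this fb fa] obtain w
    where "min b a \<le> w" "w \<le> max b a" "f w = w" by blast
  then show ?thesis using a b by (intro exI[of _ w]) linarith
qed

end

subsection \<open>Actions of Baumslag--Solitar groups\<close>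

text \<open>The conjugation relation is written without inverses so that it iterates directly under
  \<open>funpow\<close>.\<close>

locale bs_pair = f: interval_diffeo f F f' + g: interval_diffeo g G g'
  for f F f' g G g' :: "real \<Rightarrow> real" +
  fixes m :: nat
  assumes m: "m \<ge> 2"
    and rel: "x \<in> {0..1} \<Longrightarrow> f (g x) = (g ^^ m) (f x)"
begin

lemma rel_pow: "x \<in> {0..1} \<Longrightarrow> f ((g ^^ j) x) = (g ^^ (m * j)) (f x)"
proof (induction j)
  case (Suc j)
  have "f ((g ^^ Suc j) x) = (g ^^ m) (f ((g ^^ j) x))"
    using rel[OF g.pow_maps[OF Suc.prems]] by simp
  then show ?case using Suc by (simp add: funpow_add)
qed simp

lemma rel_pow_pow: "x \<in> {0..1} \<Longrightarrow> (f ^^ r) ((g ^^ j) x) = (g ^^ (m ^ r * j)) ((f ^^ r) x)"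
proof (induction r)
  case (Suc r)
  have "(f ^^ Suc r) ((g ^^ j) x) = f ((g ^^ (m ^ r * j)) ((f ^^ r) x))" using Suc by simp
  also have "\<dots> = (g ^^ (m * (m ^ r * j))) (f ((f ^^ r) x))"
    by (rule rel_pow[OF f.pow_maps[OF Suc.prems]])
  finally show ?case by (simp add: mult_ac)
qed simp

lemma pow_inv_pow_commute:
  assumes "x \<in> {0..1}"
  shows "(g ^^ j) ((F ^^ r) x) = (F ^^ r) ((g ^^ (j * m ^ r)) x)"
proof -
  have "(f ^^ r) ((g ^^ j) ((F ^^ r) x)) = (g ^^ (m ^ r * j)) x"
    using rel_pow_pow[OF f.inv_pow_maps[OF assms]] f.pow_inv_pow[OF assms] by simp
  then show ?thesis
    using f.inv_pow_pow[OF g.pow_maps[OF f.inv_pow_maps[OF assms]]] by (metis mult.commute)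
qed

text \<open>In the affine model \<open>f x = m x\<close>, \<open>g x = x + 1\<close>, the point \<open>grid y r j\<close> is \<open>(y + j) / m\<^sup>r\<close>.\<close>

definition grid :: "real \<Rightarrow> nat \<Rightarrow> nat \<Rightarrow> real" where
  "grid y r j = (F ^^ r) ((g ^^ j) y)"

lemma grid_in: "y \<in> {0..1} \<Longrightarrow> grid y r j \<in> {0..1}"
  unfolding grid_def by (intro f.inv_pow_maps g.pow_maps)

lemma f_grid: "y \<in> {0..1} \<Longrightarrow> f (grid y (Suc r) j) = grid y r j"
  unfolding grid_def by (simp add: f.right_inv f.inv_pow_maps g.pow_maps del: atLeastAtMost_iff)

lemma g_grid: "y \<in> {0..1} \<Longrightarrow> g (grid y r j) = grid y r (j + m ^ r)"
  using pow_inv_pow_commute[OF g.pow_maps, of y 1 r j]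
  by (simp add: grid_def add.commute[of j] funpow_add del: atLeastAtMost_iff)

lemma grid_less:
  assumes "y \<in> {0..1}" "y < g y"
  shows "grid y r j < grid y r (Suc j)"
proof -
  have "(g ^^ j) y < (g ^^ j) (g y)"
    using assms g.maps by (simp add: g.pow_less_iff)
  then show ?thesis unfolding grid_def
    using assms g.pow_maps g.maps by (subst f.inv_pow_less_iff) (auto simp: funpow_swap1)
qed

lemma grid_mono: "y \<in> {0..1} \<Longrightarrow> y < g y \<Longrightarrow> i \<le> j \<Longrightarrow> grid y r i \<le> grid y r j"
  by (rule lift_Suc_mono_le[of "grid y r"]) (use grid_less less_imp_le in blast)+

lemma grid_mult: "y \<in> {0..1} \<Longrightarrow> grid y r (k * m ^ r) = (g ^^ k) ((F ^^ r) y)"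
  unfolding grid_def by (simp add: pow_inv_pow_commute)

text \<open>This is \<open>tile_sum\<close> for the gaps of the grid; the mean value theorem turns
  the bounds on \<open>f'\<close> and \<open>g'\<close> over \<open>U\<close> into its hypotheses.
  Here \<open>l r\<close> is the first tile of block \<open>M\<close> and \<open>S r\<close> the
  whole block, whose gaps telescope.\<close>

lemma grid_estimate:
  fixes \<sigma> \<kappa> :: real
  assumes y: "y \<in> {0..1}" "y < g y" and \<sigma>: "\<sigma> \<ge> 1" and \<kappa>: "\<kappa> > 0"
    and U: "\<And>r j x. j \<ge> M * m ^ r \<Longrightarrow> grid y r j < x \<Longrightarrow> x < grid y r (Suc j) \<Longrightarrow> x \<in> U"
    and fU: "\<And>x. x \<in> U \<Longrightarrow> \<kappa> \<le> \<sigma> * f' x \<and> f' x \<le> \<kappa> * \<sigma>"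
    and gU: "\<And>x. x \<in> U \<Longrightarrow> 1 \<le> \<sigma> * g' x \<and> g' x \<le> \<sigma>"
  defines "l \<equiv> \<lambda>r. (g ^^ M) ((F ^^ r) (g y)) - (g ^^ M) ((F ^^ r) y)"
    and "S \<equiv> \<lambda>r. (g ^^ Suc M) ((F ^^ r) y) - (g ^^ M) ((F ^^ r) y)"
  shows "real (m ^ r) * l r \<le> (\<sigma> ^ (2 * m)) ^ r * S r"
    and "S r \<le> (\<sigma> ^ (2 * m)) ^ r * (real (m ^ r) * l r)"
proof -
  define L where "L = (\<lambda>r j. grid y r (Suc j) - grid y r j)"
  have pos: "L r j > 0" for r j using grid_less[OF y] by (simp add: L_def)
  have fL: "\<exists>\<xi>\<in>U. L r j = f' \<xi> * L (Suc r) j" if "j \<ge> M * m ^ Suc r" for r j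
  proof -
    obtain \<xi> where "grid y (Suc r) j < \<xi>" "\<xi> < grid y (Suc r) (Suc j)"
      "f (grid y (Suc r) (Suc j)) - f (grid y (Suc r) j) = f' \<xi> * L (Suc r) j"
      using f.mvt[of "grid y (Suc r) j" "grid y (Suc r) (Suc j)"] grid_less[OF y] grid_in[OF y(1)]
      unfolding L_def by fastforce
    then show ?thesis using U[OF that] unfolding L_def f_grid[OF y(1)] by blast
  qed
  have gL: "\<exists>\<xi>\<in>U. L r (j + m ^ r) = g' \<xi> * L r j" if "j \<ge> M * m ^ r" for r j
  proof -
    obtain \<xi> where "grid y r j < \<xi>" "\<xi> < grid y r (Suc j)"
      "g (grid y r (Suc j)) - g (grid y r j) = g' \<xi> * L r j"
      using g.mvt[of "grid y r j" "grid y r (Suc j)"] grid_less[OF y] grid_in[OF y(1)]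
      unfolding L_def by fastforce
    then show ?thesis using U[OF that] unfolding L_def g_grid[OF y(1)] by (auto intro!: bexI)
  qed
  have 1: "L r j \<le> \<kappa> * \<sigma> * L (Suc r) j" if h: "j \<ge> M * m ^ Suc r" for r j
  proof -
    obtain \<xi> where "\<xi> \<in> U" "L r j = f' \<xi> * L (Suc r) j" using fL[OF h] by blast
    then show ?thesis using fU[of \<xi>] pos[of "Suc r" j] by simp
  qed
  have 2: "\<kappa> * L (Suc r) j \<le> \<sigma> * L r j" if h: "j \<ge> M * m ^ Suc r" for r j
  proof -
    obtain \<xi> where "\<xi> \<in> U" "L r j = f' \<xi> * L (Suc r) j" using fL[OF h] by blast
    moreover from this have "\<kappa> * L (Suc r) j \<le> \<sigma> * f' \<xi> * L (Suc r) j"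
      using fU[of \<xi>] pos[of "Suc r" j] by (intro mult_right_mono) auto
    ultimately show ?thesis by (simp add: mult_ac)
  qed
  have 3: "L r (j + m ^ r) \<le> \<sigma> * L r j" if h: "j \<ge> M * m ^ r" for r j
  proof -
    obtain \<xi> where "\<xi> \<in> U" "L r (j + m ^ r) = g' \<xi> * L r j" using gL[OF h] by blast
    then show ?thesis using gU[of \<xi>] pos[of r j] by simp
  qed
  have 4: "L r j \<le> \<sigma> * L r (j + m ^ r)" if h: "j \<ge> M * m ^ r" for r j
  proof -
    obtain \<xi> where "\<xi> \<in> U" "L r (j + m ^ r) = g' \<xi> * L r j" using gL[OF h] by blast
    moreover from this have "1 * L r j \<le> \<sigma> * g' \<xi> * L r j"
      using gU[of \<xi>] pos[of r j] by (intro mult_right_mono) auto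
    ultimately show ?thesis by (simp add: mult_ac)
  qed
  have m1: "m \<ge> 1" using m by simp
  have "(\<Sum>j<m ^ r. L r (M * m ^ r + j)) = grid y r (M * m ^ r + m ^ r) - grid y r (M * m ^ r)"
    unfolding L_def using sum_lessThan_telescope[of "\<lambda>j. grid y r (M * m ^ r + j)" "m ^ r"] by simp
  also have "M * m ^ r + m ^ r = Suc M * m ^ r" by simp
  finally have S: "(\<Sum>j<m ^ r. L r (M * m ^ r + j)) = S r"
    by (simp only: S_def grid_mult[OF y(1)])
  \<comment> \<open>The right end of the first tile has index \<open>M * m ^ r + 1\<close>. Read as
    a grid point based at \<open>g y\<close>, its index is a multiple of \<open>m ^ r\<close>
    again.\<close>
  have "grid y r (Suc (M * m ^ r)) = (F ^^ r) ((g ^^ (M * m ^ r)) (g y))"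
    by (simp only: grid_def funpow_Suc_right comp_def)
  then have l: "L r (M * m ^ r) = l r"
    using pow_inv_pow_commute[OF g.maps[OF y(1)], of M r]
    by (simp add: L_def l_def grid_mult[OF y(1)])
  note * = tile_sum[of \<sigma> \<kappa> m L M r, OF \<sigma> \<kappa> m1 pos 1 2 3 4, unfolded S l]
  show "real (m ^ r) * l r \<le> (\<sigma> ^ (2 * m)) ^ r * S r"
    "S r \<le> (\<sigma> ^ (2 * m)) ^ r * (real (m ^ r) * l r)"
    using * by auto
qed

end

section \<open>Dynamics on a component where \<open>g\<close> moves points up\<close>

lemma exists_pow_less:
  fixes c :: real
  assumes "c > 1" "N > 0"
  shows "\<exists>\<sigma>>1. \<sigma> ^ N < c"
proof -
  have "root N ((1 + c) / 2) > 1" using assms real_root_less_mono[of N 1 "(1 + c) / 2"] by simp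
  moreover have "root N ((1 + c) / 2) ^ N < c" using assms by (simp add: real_root_pow_pos2)
  ultimately show ?thesis by blast
qed

text \<open>Only the upward direction is treated; a component on which \<open>g\<close> moves points
  down is handled later by passing to the inverse of \<open>g\<close>.\<close>

locale bs_component = bs_pair +
  fixes p q :: real
  assumes p0: "0 \<le> p" and pq: "p < q" and q1: "q \<le> 1"
    and gp: "g p = p" and gq: "g q = q"
    and moves: "p < x \<Longrightarrow> x < q \<Longrightarrow> x < g x"
begin

lemma p_in: "p \<in> {0..1}" and q_in: "q \<in> {0..1}"
  using p0 pq q1 by auto

lemma between_in: "p < x \<Longrightarrow> x < q \<Longrightarrow> x \<in> {0..1}"
  using p0 q1 by auto

lemma g_pow_between: "p < x \<Longrightarrow> x < q \<Longrightarrow> p < (g ^^ k) x \<and> (g ^^ k) x < q"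
  using g.pow_less_iff[of p x k] g.pow_less_iff[of x q k] between_in[of x] p_in q_in
    g.pow_fixed[OF gp] g.pow_fixed[OF gq] by simp

lemma g_pow_mono: "p < x \<Longrightarrow> x < q \<Longrightarrow> i \<le> j \<Longrightarrow> (g ^^ i) x \<le> (g ^^ j) x"
proof (rule lift_Suc_mono_le[of "\<lambda>i. (g ^^ i) x"])
  fix n assume "p < x" "x < q"
  then show "(g ^^ n) x \<le> (g ^^ Suc n) x"
    using moves[of "(g ^^ n) x"] g_pow_between[of x n] by simp
qed

lemma g_pow_gt: "p < x \<Longrightarrow> x < q \<Longrightarrow> k > 0 \<Longrightarrow> x < (g ^^ k) x"
  using g_pow_mono[of x 1 k] moves[of x] by simp

text \<open>The orbit increases to a fixed point of \<open>g\<close>, and \<open>q\<close> is the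
  only fixed point in \<open>[x, q]\<close>.\<close>

lemma g_pow_tendsto:
  assumes x: "p < x" "x < q"
  shows "(\<lambda>k. (g ^^ k) x) \<longlonglongrightarrow> q"
proof -
  have inc: "incseq (\<lambda>k. (g ^^ k) x)" using g_pow_mono[OF x] by (simp add: incseq_def)
  have "\<exists>l. (\<lambda>k. (g ^^ k) x) \<longlonglongrightarrow> l"
    by (rule incseq_convergent[OF inc, of q]) (use g_pow_between[OF x] in \<open>auto intro: less_imp_le\<close>)
  then obtain l where l: "(\<lambda>k. (g ^^ k) x) \<longlonglongrightarrow> l" by blast
  have "x \<le> l" using incseq_le[OF inc l, of 0] by simp
  moreover have "l \<le> q"
    by (rule LIMSEQ_le_const2[OF l]) (use g_pow_between[OF x] in \<open>auto intro: less_imp_le\<close>)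
  moreover have "g l = l" by (rule g.limit_fixed[OF between_in[OF x] l])
  ultimately show ?thesis using l moves[of l] x by (cases "l = q") auto
qed

text \<open>The relation makes \<open>f z\<close> a fixed point of \<open>g ^^ m\<close>, which
  moves every point of the component up.\<close>

lemma f_fixed_not_between: "z \<in> {0..1} \<Longrightarrow> g z = z \<Longrightarrow> p < f z \<Longrightarrow> \<not> f z < q"
  using rel[of z] g_pow_gt[of "f z" m] m by auto

lemma inv_pow_g_fixed: "z \<in> {0..1} \<Longrightarrow> g z = z \<Longrightarrow> g ((F ^^ k) z) = (F ^^ k) z"
  using pow_inv_pow_commute[of z 1 k] g.pow_fixed[of z "m ^ k"] by simp

text \<open>
  Inside the small interval \<open>F\<^sup>r (p, q)\<close> there are \<open>m\<^sup>r\<close> tiles of almost the same size, but the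
  ratio of the first tile to the interval decays slower than any exponential.
\<close>

lemma not_wandering:
  assumes lim: "(\<lambda>k. (F ^^ k) p) \<longlonglongrightarrow> x0" "(\<lambda>k. (F ^^ k) q) \<longlonglongrightarrow> x0"
  shows False
proof -
  define P Q where "P = (\<lambda>k. (F ^^ k) p)" and "Q = (\<lambda>k. (F ^^ k) q)"
  have PQ: "P k < Q k" for k unfolding P_def Q_def using f.inv_pow_less_iff[OF p_in q_in] pq by simp
  have P_in: "P k \<in> {0..1}" and Q_in: "Q k \<in> {0..1}" for k
    unfolding P_def Q_def using f.inv_pow_maps p_in q_in by blast+
  have P_lim: "P \<longlonglongrightarrow> x0" and Q_lim: "Q \<longlonglongrightarrow> x0" using lim unfolding P_def Q_def .
  have x0: "x0 \<in> {0..1}"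
    by (rule closed_sequentially[OF _ _ P_lim]) (use P_in in auto)
  \<comment> \<open>Both ends of \<open>F\<^sup>k (p, q)\<close> are fixed by \<open>g\<close>, so
    \<open>g'\<close> equals 1 somewhere inside; in the limit \<open>g' x0 = 1\<close>.\<close>
  have "\<exists>\<xi>. P k < \<xi> \<and> \<xi> < Q k \<and> g' \<xi> = 1" for k
  proof -
    obtain \<xi> where "P k < \<xi>" "\<xi> < Q k" "g (Q k) - g (P k) = g' \<xi> * (Q k - P k)"
      using g.mvt[OF _ PQ] P_in Q_in by (meson atLeastAtMost_iff)
    moreover have "g (Q k) = Q k" "g (P k) = P k"
      unfolding P_def Q_def by (intro inv_pow_g_fixed q_in p_in gp gq)+
    ultimately show ?thesis using PQ[of k] by (intro exI[of _ \<xi>]) simp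
  qed
  then obtain \<xi> where \<xi>: "\<And>k. P k < \<xi> k" "\<And>k. \<xi> k < Q k" "\<And>k. g' (\<xi> k) = 1" by metis
  have "\<xi> \<longlonglongrightarrow> x0"
    by (rule tendsto_sandwich[OF _ _ P_lim Q_lim]) (auto intro!: always_eventually less_imp_le \<xi>)
  moreover have "\<xi> k \<in> {0..1}" for k using \<xi>(1,2)[of k] P_in[of k] Q_in[of k] by auto
  ultimately have "(\<lambda>k. g' (\<xi> k)) \<longlonglongrightarrow> g' x0"
    by (intro continuous_on_tendsto_compose[OF g.cont_deriv _ x0]) auto
  then have g1: "g' x0 = 1" by (simp add: \<xi>(3) LIMSEQ_const_iff)
  \<comment> \<open>The exponent counts the losses per level: \<open>2 * m\<close> from comparing
    tiles, one from \<open>a_low\<close> and one from \<open>D_up\<close>.\<close>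
  obtain \<sigma> :: real where \<sigma>: "\<sigma> > 1" "\<sigma> ^ (2 * m + 2) < m"
    using exists_pow_less[of "real m" "2 * m + 2"] m by auto
  define \<kappa> where "\<kappa> = f' x0"
  have \<kappa>: "\<kappa> > 0" unfolding \<kappa>_def by (rule f.deriv_pos[OF x0])
  obtain \<delta>1 where \<delta>1: "\<delta>1 > 0" "\<And>x. x \<in> {0..1} \<Longrightarrow> \<bar>x - x0\<bar> < \<delta>1 \<Longrightarrow> \<kappa> \<le> \<sigma> * f' x \<and> f' x \<le> \<kappa> * \<sigma>"
    using f.deriv_near[OF x0 \<sigma>(1)] unfolding \<kappa>_def by meson
  obtain \<delta>2 where \<delta>2: "\<delta>2 > 0" "\<And>x. x \<in> {0..1} \<Longrightarrow> \<bar>x - x0\<bar> < \<delta>2 \<Longrightarrow> 1 \<le> \<sigma> * g' x \<and> g' x \<le> \<sigma>"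
    using g.deriv_near[OF x0 \<sigma>(1)] unfolding g1 by auto
  have "\<forall>\<^sub>F k in sequentially. dist (P k) x0 < min \<delta>1 \<delta>2 \<and> dist (Q k) x0 < min \<delta>1 \<delta>2"
    by (intro eventually_conj tendstoD[OF P_lim] tendstoD[OF Q_lim]) (use \<delta>1 \<delta>2 in auto)
  then obtain R where R: "\<And>k. k \<ge> R \<Longrightarrow> \<bar>P k - x0\<bar> < min \<delta>1 \<delta>2 \<and> \<bar>Q k - x0\<bar> < min \<delta>1 \<delta>2"
    unfolding eventually_sequentially dist_real_def by blast
  define U where "U = {x. \<exists>k\<ge>R. P k < x \<and> x < Q k}"
  have U_near: "x \<in> {0..1} \<and> \<bar>x - x0\<bar> < \<delta>1 \<and> \<bar>x - x0\<bar> < \<delta>2" if x: "x \<in> U" for x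
  proof -
    obtain k where k: "k \<ge> R" "P k < x" "x < Q k" using x by (auto simp: U_def)
    then show ?thesis using R[OF k(1)] P_in[of k] Q_in[of k] by (auto simp: abs_less_iff)
  qed
  have fU: "\<kappa> \<le> \<sigma> * f' x \<and> f' x \<le> \<kappa> * \<sigma>" if "x \<in> U" for x using \<delta>1(2) U_near[OF that] by blast
  have gU: "1 \<le> \<sigma> * g' x \<and> g' x \<le> \<sigma>" if "x \<in> U" for x using \<delta>2(2) U_near[OF that] by blast
  \<comment> \<open>Starting from level \<open>R\<close> keeps the whole grid of \<open>y\<close>
    inside \<open>U\<close>, where both derivatives are under control.\<close>
  define y where "y = (F ^^ R) ((p + q) / 2)"
  have mid: "p < (p + q) / 2" "(p + q) / 2 < q" using pq by simp_all
  have inP: "P (r + k) < (F ^^ r) x \<and> (F ^^ r) x < Q (r + k)" if "P k < x" "x < Q k" for r k x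
  proof -
    have x: "x \<in> {0..1}" using that P_in[of k] Q_in[of k] by auto
    show ?thesis
      using f.inv_pow_less_iff[OF P_in[of k] x, of r] f.inv_pow_less_iff[OF x Q_in[of k], of r] that
      by (simp add: P_def Q_def funpow_add)
  qed
  have yPQ: "P R < y" "y < Q R" using inP[of 0 "(p + q) / 2" R] mid by (auto simp: y_def P_def Q_def)
  have y_in: "y \<in> {0..1}" unfolding y_def by (intro f.inv_pow_maps between_in mid)
  have gy: "y < g y"
  proof -
    have "(F ^^ R) ((p + q) / 2) < (F ^^ R) ((g ^^ (m ^ R)) ((p + q) / 2))"
      using f.inv_pow_less_iff[OF between_in[OF mid] g.pow_maps[OF between_in[OF mid]], of R "m ^ R"]
        g_pow_gt[OF mid, of "m ^ R"] m by simp
    then show ?thesis using pow_inv_pow_commute[OF between_in[OF mid], of 1 R] by (simp add: y_def)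
  qed
  have gyPQ: "P R < (g ^^ j) y \<and> (g ^^ j) y < Q R" for j
  proof -
    have "(g ^^ j) (P R) = P R" "(g ^^ j) (Q R) = Q R"
      unfolding P_def Q_def by (intro g.pow_fixed inv_pow_g_fixed p_in q_in gp gq)+
    then show ?thesis
      using g.pow_less_iff[OF P_in[of R] y_in, of j] g.pow_less_iff[OF y_in Q_in[of R], of j] yPQ by simp
  qed
  have U: "x \<in> U" if "grid y r j < x" "x < grid y r (Suc j)" for r j x
  proof -
    have "P (r + R) < x \<and> x < Q (r + R)"
      using that inP[of R "(g ^^ j) y" r] inP[of R "(g ^^ Suc j) y" r] gyPQ
      unfolding grid_def by (meson less_trans)
    then show ?thesis unfolding U_def by (auto intro!: exI[of _ "r + R"])
  qed
  define a where "a = (\<lambda>r. (F ^^ r) (g y) - (F ^^ r) y)"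
  define D where "D = (\<lambda>r. Q (r + R) - P (r + R))"
  have FyPQ: "P (r + R) < (F ^^ r) y" "(F ^^ r) (g y) < Q (r + R)" "(F ^^ r) y < (F ^^ r) (g y)" for r
    using inP[of R y r] inP[of R "g y" r] yPQ gyPQ[of 1] f.inv_pow_less_iff[OF y_in g.maps[OF y_in], of r] gy
    by auto
  have "real (m ^ r) * a r \<le> (\<sigma> ^ (2 * m)) ^ r * D r" for r
  proof -
    \<comment> \<open>Block 0 suffices: all tiles are already near \<open>x0\<close>, and no
      preliminary translation by \<open>g\<close> is needed.\<close>
    have "real (m ^ r) * a r \<le> (\<sigma> ^ (2 * m)) ^ r * (g ((F ^^ r) y) - (F ^^ r) y)"
      using grid_estimate(1)[OF y_in gy _ \<kappa>, of \<sigma> 0 U r] U fU gU \<sigma>(1) by (simp add: a_def)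
    also have "g ((F ^^ r) y) - (F ^^ r) y \<le> D r"
    proof -
      have "g ((F ^^ r) y) = (F ^^ r) ((g ^^ (m ^ r)) y)"
        using pow_inv_pow_commute[OF y_in, of 1 r] by simp
      then have "g ((F ^^ r) y) < Q (r + R)" using inP[of R "(g ^^ (m ^ r)) y" r] gyPQ by simp
      then show ?thesis using FyPQ(1)[of r] by (simp add: D_def)
    qed
    finally show ?thesis using \<sigma>(1) by (simp add: mult_left_mono)
  qed
  \<comment> \<open>One application of \<open>F\<close> divides the tile by at most
    \<open>\<kappa> * \<sigma>\<close> and the surrounding interval by at least
    \<open>\<kappa> / \<sigma>\<close>. The powers of \<open>\<kappa>\<close> cancel when both
    bounds are combined, leaving only powers of \<open>\<sigma>\<close>.\<close>
  moreover have a_low: "a 0 \<le> (\<kappa> * \<sigma>) ^ r * a r" for r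
  proof (induction r)
    case (Suc r)
    obtain \<xi> where \<xi>: "(F ^^ Suc r) y < \<xi>" "\<xi> < (F ^^ Suc r) (g y)"
      "f ((F ^^ Suc r) (g y)) - f ((F ^^ Suc r) y) = f' \<xi> * a (Suc r)"
      using f.mvt[OF _ FyPQ(3)[of "Suc r"]] f.inv_pow_maps[OF y_in, of "Suc r"]
        f.inv_pow_maps[OF g.maps[OF y_in], of "Suc r"] unfolding a_def by (meson atLeastAtMost_iff)
    have "\<xi> \<in> U" unfolding U_def using \<xi>(1,2) FyPQ(1,2)[of "Suc r"]
      by (auto intro!: exI[of _ "Suc r + R"])
    then have "f' \<xi> * a (Suc r) \<le> \<kappa> * \<sigma> * a (Suc r)"
      using fU[of \<xi>] FyPQ(3)[of "Suc r"] by (intro mult_right_mono) (auto simp: a_def)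
    moreover have "f ((F ^^ Suc r) (g y)) = (F ^^ r) (g y)" "f ((F ^^ Suc r) y) = (F ^^ r) y"
      using f.right_inv f.inv_pow_maps[OF y_in, of r] f.inv_pow_maps[OF g.maps[OF y_in], of r] by auto
    ultimately have "a r \<le> \<kappa> * \<sigma> * a (Suc r)" using \<xi>(3) by (simp add: a_def)
    then have "(\<kappa> * \<sigma>) ^ r * a r \<le> (\<kappa> * \<sigma>) ^ r * (\<kappa> * \<sigma> * a (Suc r))"
      using \<kappa> \<sigma> by (intro mult_left_mono) auto
    with Suc show ?case by (simp add: mult_ac)
  qed simp
  moreover have D_up: "\<kappa> ^ r * D r \<le> \<sigma> ^ r * D 0" for r
  proof (induction r)
    case (Suc r)
    obtain \<xi> where \<xi>: "P (Suc r + R) < \<xi>" "\<xi> < Q (Suc r + R)"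
      "f (Q (Suc r + R)) - f (P (Suc r + R)) = f' \<xi> * D (Suc r)"
      using f.mvt[OF _ PQ[of "Suc r + R"]] P_in Q_in unfolding D_def by (meson atLeastAtMost_iff)
    have "\<xi> \<in> U" unfolding U_def using \<xi>(1,2) by (auto intro!: exI[of _ "Suc r + R"])
    then have "\<kappa> * D (Suc r) \<le> \<sigma> * f' \<xi> * D (Suc r)"
      using fU[of \<xi>] PQ[of "Suc r + R"] by (intro mult_right_mono) (auto simp: D_def)
    moreover have "f (Q (Suc r + R)) = Q (r + R)" "f (P (Suc r + R)) = P (r + R)"
      using f.right_inv[OF P_in] f.right_inv[OF Q_in] by (auto simp: P_def Q_def)
    ultimately have "\<kappa> * D (Suc r) \<le> \<sigma> * D r" using \<xi>(3) by (simp add: D_def)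
    then have "\<kappa> ^ r * (\<kappa> * D (Suc r)) \<le> \<kappa> ^ r * (\<sigma> * D r)"
      using \<kappa> by (intro mult_left_mono) auto
    also have "\<dots> \<le> \<sigma> * (\<sigma> ^ r * D 0)" using Suc \<sigma> by (simp add: mult.left_commute mult_left_mono)
    finally show ?case by (simp add: mult_ac)
  qed simp
  ultimately have key: "real m ^ r * a 0 \<le> (\<sigma> ^ (2 * m + 2)) ^ r * D 0" for r
  proof -
    assume est: "\<And>r. real (m ^ r) * a r \<le> (\<sigma> ^ (2 * m)) ^ r * D r"
    have "real m ^ r * a 0 \<le> real m ^ r * ((\<kappa> * \<sigma>) ^ r * a r)"
      by (intro mult_left_mono a_low) auto
    also have "\<dots> = (\<kappa> * \<sigma>) ^ r * (real (m ^ r) * a r)" by simp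
    also have "\<dots> \<le> (\<kappa> * \<sigma>) ^ r * ((\<sigma> ^ (2 * m)) ^ r * D r)"
      using \<kappa> \<sigma> by (intro mult_left_mono est) auto
    also have "\<dots> = \<sigma> ^ r * (\<sigma> ^ (2 * m)) ^ r * (\<kappa> ^ r * D r)" by (simp add: power_mult_distrib mult_ac)
    also have "\<dots> \<le> \<sigma> ^ r * (\<sigma> ^ (2 * m)) ^ r * (\<sigma> ^ r * D 0)"
      using \<sigma> by (intro mult_left_mono D_up) auto
    also have "\<dots> = (\<sigma> * \<sigma> ^ (2 * m) * \<sigma>) ^ r * D 0" by (simp add: power_mult_distrib mult_ac)
    also have "\<sigma> * \<sigma> ^ (2 * m) * \<sigma> = \<sigma> ^ (2 * m + 2)" by (simp add: power2_eq_square)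
    finally show ?thesis .
  qed
  define \<tau> where "\<tau> = \<sigma> ^ (2 * m + 2)"
  have \<tau>: "\<tau> > 0" "\<tau> < m" using \<sigma> by (auto simp: \<tau>_def simp del: power_Suc)
  have a0: "a 0 > 0" using gy by (simp add: a_def)
  obtain r where "D 0 / a 0 < (real m / \<tau>) ^ r" using real_arch_pow[of "real m / \<tau>"] \<tau> by auto
  then have "\<tau> ^ r * D 0 < real m ^ r * a 0" using a0 \<tau> by (simp add: field_simps)
  with key[of r] show False by (simp add: \<tau>_def)
qed

text \<open>\<open>F\<close> maps \<open>(p, q)\<close> to an interval with ends fixed by
  \<open>g\<close> and no fixed point of \<open>g\<close> inside, so the image is
  \<open>(p, q)\<close> or disjoint from it. In the disjoint case the iterates march monotonically
  to one point, which \<open>not_wandering\<close> excludes.\<close>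

lemma f_fixes_ends: "f p = p" "f q = q"
proof -
  have Fp: "F p \<in> {0..1}" and Fq: "F q \<in> {0..1}" using f.inv_maps p_in q_in by auto
  have FpFq: "F p < F q" using f.inv_less_iff[OF p_in q_in] pq by simp
  have gFp: "g (F p) = F p" and gFq: "g (F q) = F q"
    using inv_pow_g_fixed[OF p_in gp, of 1] inv_pow_g_fixed[OF q_in gq, of 1] by simp_all
  have not_btw: "\<not> (p < z \<and> z < q)" if "g z = z" for z using moves[of z] that by auto
  have no_inside: "\<not> (F p < z \<and> z < F q)" if "z \<in> {0..1}" "g z = z" for z
    using f_fixed_not_between[OF that] f.less_iff[OF Fp that(1)] f.less_iff[OF that(1) Fq]
      f.right_inv[OF p_in] f.right_inv[OF q_in] by auto
  have P_in: "(F ^^ k) p \<in> {0..1}" and Q_in: "(F ^^ k) q \<in> {0..1}" for k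
    using f.inv_pow_maps p_in q_in by blast+
  have PQ: "(F ^^ k) p < (F ^^ k) q" for k using f.inv_pow_less_iff[OF p_in q_in] pq by simp
  have "F p = p"
  proof (rule ccontr)
    assume "F p \<noteq> p"
    then consider "F p < p" | "F p \<ge> q" using not_btw[OF gFp] by linarith
    then show False
    proof cases
      case 1
      have "F q \<le> p" using no_inside[OF p_in gp] 1 by linarith
      then have QP: "(F ^^ Suc k) q \<le> (F ^^ k) p" for k
        using f.inv_pow_le_iff[OF Fq p_in, of k] by (simp add: funpow_swap1)
      have "decseq (\<lambda>k. (F ^^ k) p)"
        by (rule decseq_SucI) (use QP PQ less_imp_le order_trans in blast)
      moreover have "\<forall>k. 0 \<le> (F ^^ k) p" using P_in by auto
      ultimately obtain x0 where x0: "(\<lambda>k. (F ^^ k) p) \<longlonglongrightarrow> x0"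
        using decseq_convergent[of "\<lambda>k. (F ^^ k) p" 0] by blast
      \<comment> \<open>The intervals are interlaced, so the right ends are squeezed to the limit of
        the left ends.\<close>
      have "(\<lambda>k. (F ^^ Suc k) q) \<longlonglongrightarrow> x0"
        by (rule tendsto_sandwich[OF _ _ LIMSEQ_Suc[OF x0] x0])
          (intro always_eventually allI QP less_imp_le[OF PQ])+
      then have "(\<lambda>k. (F ^^ k) q) \<longlonglongrightarrow> x0" by (rule LIMSEQ_imp_Suc)
      with x0 show False by (rule not_wandering)
    next
      case 2
      then have QP: "(F ^^ k) q \<le> (F ^^ Suc k) p" for k
        using f.inv_pow_le_iff[OF q_in Fp, of k] by (simp add: funpow_swap1)
      have "incseq (\<lambda>k. (F ^^ k) q)"
        by (rule incseq_SucI) (use QP PQ less_imp_le order_trans in blast)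
      moreover have "\<forall>k. (F ^^ k) q \<le> 1" using Q_in by auto
      ultimately obtain x0 where x0: "(\<lambda>k. (F ^^ k) q) \<longlonglongrightarrow> x0"
        using incseq_convergent[of "\<lambda>k. (F ^^ k) q" 1] by blast
      have "(\<lambda>k. (F ^^ Suc k) p) \<longlonglongrightarrow> x0"
        by (rule tendsto_sandwich[OF _ _ x0 LIMSEQ_Suc[OF x0]])
          (intro always_eventually allI QP less_imp_le[OF PQ])+
      then have "(\<lambda>k. (F ^^ k) p) \<longlonglongrightarrow> x0" by (rule LIMSEQ_imp_Suc)
      from this x0 show False by (rule not_wandering)
    qed
  qed
  moreover from this have "F q = q"
    using not_btw[OF gFq] no_inside[OF q_in gq] FpFq pq by linarith
  ultimately show "f p = p" "f q = q" using f.inv_fixed_iff p_in q_in by auto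
qed

lemma f_between: "p < x \<Longrightarrow> x < q \<Longrightarrow> p < f x \<and> f x < q"
  using f.less_iff[of p x] f.less_iff[of x q] f_fixes_ends between_in[of x] p_in q_in by auto

lemma F_pow_between: "p < x \<Longrightarrow> x < q \<Longrightarrow> p < (F ^^ k) x \<and> (F ^^ k) x < q"
  using f.inv_pow_less_iff[of p x k] f.inv_pow_less_iff[of x q k] between_in[of x] p_in q_in
    f.inv_pow_fixed[of p k] f.inv_pow_fixed[of q k] f.inv_fixed_iff f_fixes_ends by simp

lemma exists_f_fixed: "\<exists>s. p < s \<and> s < q \<and> f s = s"
proof -
  define x where "x = (p + q) / 2"
  have x: "p < x" "x < q" using pq by (simp_all add: x_def)
  have fx: "p < f x" "f x < q" using f_between[OF x] by auto
  have reach: "\<exists>j. b < (g ^^ j) a" if "p < a" "a < q" "b < q" for a b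
    using order_tendstoD(1)[OF g_pow_tendsto[OF that(1,2)] that(3)]
    unfolding eventually_sequentially by auto
  \<comment> \<open>Of at least \<open>2 * j\<close> steps available in
    \<open>(g ^^ (m * j)) (f x)\<close>, the first \<open>j\<close> pass \<open>x\<close> and the
    next \<open>j\<close> pass \<open>v\<close>; hence \<open>f\<close> pushes \<open>v\<close>
    up.\<close>
  obtain j where j: "x < (g ^^ j) (f x)" using reach[OF fx x(2)] by blast
  define v where "v = (g ^^ j) x"
  have v: "p < v" "v < q" using g_pow_between[OF x] by (auto simp: v_def)
  have jm: "j + j \<le> m * j" using m by (metis mult_2 mult_le_mono1)
  have "v \<le> (g ^^ j) ((g ^^ j) (f x))"
    unfolding v_def using j g.pow_le_iff[of x "(g ^^ j) (f x)" j] between_in[OF x] g.pow_maps[OF between_in[OF fx]]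
    by simp
  also have "\<dots> \<le> (g ^^ (m * j)) (f x)"
    using g_pow_mono[OF fx jm] by (simp add: funpow_add)
  also have "\<dots> = f v" unfolding v_def using rel_pow[OF between_in[OF x]] by simp
  finally have fv: "v \<le> f v" .
  \<comment> \<open>The backward counterpart: \<open>u\<close> lies \<open>k\<close> steps before
    \<open>x\<close>, and cancelling \<open>2 * k\<close> steps of \<open>g\<close> from
    \<open>f x < (g ^^ k) x\<close> shows that \<open>f\<close> pushes \<open>u\<close>
    down.\<close>
  obtain k where k: "f x < (g ^^ k) x" using reach[OF x fx(2)] by blast
  define u where "u = (G ^^ k) x"
  have gu: "(g ^^ k) u = x" unfolding u_def by (rule g.pow_inv_pow[OF between_in[OF x]])
  have u_in: "u \<in> {0..1}" unfolding u_def by (rule g.inv_pow_maps[OF between_in[OF x]])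
  have u: "p < u" "u < q"
    using g.pow_less_iff[OF p_in u_in, of k] g.pow_less_iff[OF u_in q_in, of k] gu x
      g.pow_fixed[OF gp, of k] g.pow_fixed[OF gq, of k] by auto
  have fu': "p < f u" "f u < q" using f_between[OF u] by auto
  have km: "k + k \<le> m * k" using m by (metis mult_2 mult_le_mono1)
  have "(g ^^ (k + k)) (f u) \<le> (g ^^ (m * k)) (f u)" by (rule g_pow_mono[OF fu' km])
  also have "\<dots> = f x" using rel_pow[OF u_in, of k] gu by simp
  also have "\<dots> \<le> (g ^^ (k + k)) u" using k gu by (simp add: funpow_add)
  finally have fu: "f u \<le> u" using g.pow_le_iff[OF f.maps[OF u_in] u_in] by blast
  have "continuous_on {min u v..max u v} f"
    by (rule continuous_on_subset[OF f.cont]) (use u v p0 q1 in auto)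
  from exists_fixed_point_between[OF this fu fv] obtain s
    where "min u v \<le> s" "s \<le> max u v" "f s = s" by blast
  then show ?thesis using u v by (intro exI[of _ s]) linarith
qed

text \<open>Differentiating the relation at the common fixed point \<open>q\<close> gives
  \<open>g' q = g' q ^ m\<close>; a positive number with this property is 1 because
  \<open>m \<ge> 2\<close>.\<close>

lemma g_deriv_at_end: "g' q = 1"
proof -
  have I: "f ` {0..1} \<subseteq> {0..1}" "g ` {0..1} \<subseteq> {0..1}" using f.maps g.maps by blast+
  have "(f \<circ> g has_real_derivative f' q * g' q) (at q within {0..1})"
  proof (rule DERIV_image_chain[OF _ g.deriv[OF q_in]])
    show "(f has_real_derivative f' q) (at (g q) within g ` {0..1})"
      unfolding gq by (rule DERIV_subset[OF f.deriv[OF q_in] I(2)])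
  qed
  moreover have "((g ^^ m) \<circ> f has_real_derivative g' q ^ m * f' q) (at q within {0..1})"
  proof (rule DERIV_image_chain[OF _ f.deriv[OF q_in]])
    show "((g ^^ m) has_real_derivative g' q ^ m) (at (f q) within f ` {0..1})"
      unfolding f_fixes_ends(2) by (rule DERIV_subset[OF g.pow_deriv_fixed[OF q_in gq] I(1)])
  qed
  then have "(f \<circ> g has_real_derivative g' q ^ m * f' q) (at q within {0..1})"
    by (rule has_field_derivative_transform_within[OF _ zero_less_one q_in]) (simp add: rel)
  ultimately have "f' q * g' q = g' q ^ m * f' q"
    by (rule has_real_derivative_unique_unit_interval[OF q_in])
  then have "g' q ^ m = g' q" using f.deriv_pos[OF q_in] by simp
  moreover have "g' q ^ m = g' q ^ (m - 1) * g' q" using m by (simp add: power_eq_if)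
  ultimately have "g' q ^ (m - 1) = 1" using g.deriv_pos[OF q_in] by simp
  then show ?thesis using g.deriv_pos[OF q_in] m power_eq_iff_eq_base[of "m - 1" "g' q" 1] by simp
qed

text \<open>
  The lengths are compared on the translate by \<open>g\<^sup>M\<close>, that is, close to \<open>q\<close>, where \<open>g'\<close> is
  almost 1 and \<open>f'\<close> almost constant.
\<close>

lemma fixed_grid_bounds:
  fixes \<rho> :: real
  assumes s: "p < s" "s < q" "f s = s" and \<rho>: "\<rho> > 1"
  shows "\<exists>c>0. \<exists>C. \<forall>r. real (m ^ r) * ((F ^^ r) (g s) - s) \<le> C * \<rho> ^ r \<and>
    c \<le> \<rho> ^ r * (real (m ^ r) * ((F ^^ r) (g s) - s))"
proof -
  \<comment> \<open>With this root the distortion per level is exactly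
    \<open>\<rho>\<close>.\<close>
  define \<sigma> where "\<sigma> = root (2 * m) \<rho>"
  have \<sigma>: "\<sigma> > 1" unfolding \<sigma>_def using \<rho> m real_root_less_mono[of "2 * m" 1 \<rho>] by simp
  have \<sigma>\<rho>: "\<sigma> ^ (2 * m) = \<rho>" unfolding \<sigma>_def using \<rho> m by (intro real_root_pow_pos2) auto
  define \<kappa> where "\<kappa> = f' q"
  have \<kappa>: "\<kappa> > 0" unfolding \<kappa>_def by (rule f.deriv_pos[OF q_in])
  obtain \<delta>1 where \<delta>1: "\<delta>1 > 0" "\<And>x. x \<in> {0..1} \<Longrightarrow> \<bar>x - q\<bar> < \<delta>1 \<Longrightarrow> \<kappa> \<le> \<sigma> * f' x \<and> f' x \<le> \<kappa> * \<sigma>"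
    using f.deriv_near[OF q_in \<sigma>] unfolding \<kappa>_def by meson
  obtain \<delta>2 where \<delta>2: "\<delta>2 > 0" "\<And>x. x \<in> {0..1} \<Longrightarrow> \<bar>x - q\<bar> < \<delta>2 \<Longrightarrow> 1 \<le> \<sigma> * g' x \<and> g' x \<le> \<sigma>"
    using g.deriv_near[OF q_in \<sigma>] unfolding g_deriv_at_end by auto
  have "q - min \<delta>1 \<delta>2 < q" using \<delta>1(1) \<delta>2(1) by simp
  from order_tendstoD(1)[OF g_pow_tendsto[OF s(1,2)] this]
  obtain M where M: "q - min \<delta>1 \<delta>2 < (g ^^ M) s" unfolding eventually_sequentially by blast
  define U where "U = {(g ^^ M) s<..<q}"
  have U_near: "x \<in> {0..1} \<and> \<bar>x - q\<bar> < \<delta>1 \<and> \<bar>x - q\<bar> < \<delta>2" if "x \<in> U" for x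
    using that M q1 g_pow_between[OF s(1,2), of M] p0 by (auto simp: U_def)
  have fU: "\<kappa> \<le> \<sigma> * f' x \<and> f' x \<le> \<kappa> * \<sigma>" if "x \<in> U" for x using \<delta>1(2) U_near[OF that] by blast
  have gU: "1 \<le> \<sigma> * g' x \<and> g' x \<le> \<sigma>" if "x \<in> U" for x using \<delta>2(2) U_near[OF that] by blast
  have s_in: "s \<in> {0..1}" by (rule between_in[OF s(1,2)])
  have gs: "s < g s" by (rule moves[OF s(1,2)])
  have Fs: "(F ^^ r) s = s" for r using f.inv_fixed_iff[OF s_in] s(3) by (simp add: f.inv_pow_fixed)
  have U: "x \<in> U" if j: "j \<ge> M * m ^ r" and x: "grid s r j < x" "x < grid s r (Suc j)" for r j x
  proof -
    have "(g ^^ M) s \<le> grid s r j"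
      using grid_mono[OF s_in gs j, of r] by (simp add: grid_mult[OF s_in] Fs)
    moreover have "grid s r (Suc j) < q"
      unfolding grid_def using g_pow_between[OF s(1,2), of "Suc j"] F_pow_between by blast
    ultimately show ?thesis using x by (simp add: U_def)
  qed
  \<comment> \<open>\<open>M\<close> depends on \<open>\<rho>\<close> but not on \<open>r\<close>,
    so undoing the translation by \<open>g ^^ M\<close> costs constants only.\<close>
  obtain c C where cC: "c > 0" "C > 0"
    "\<And>u v. 0 \<le> u \<Longrightarrow> u < v \<Longrightarrow> v \<le> 1 \<Longrightarrow> c * (v - u) \<le> (g ^^ M) v - (g ^^ M) u"
    "\<And>u v. 0 \<le> u \<Longrightarrow> u < v \<Longrightarrow> v \<le> 1 \<Longrightarrow> (g ^^ M) v - (g ^^ M) u \<le> C * (v - u)"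
    using g.pow_bilipschitz[of M] by metis
  \<comment> \<open>The length of the whole block is the same at every level because
    \<open>F\<close> fixes \<open>s\<close>.\<close>
  define B where "B = (g ^^ Suc M) s - (g ^^ M) s"
  define l where "l = (\<lambda>r. (F ^^ r) (g s) - s)"
  define e where "e = (\<lambda>r. (g ^^ M) ((F ^^ r) (g s)) - (g ^^ M) s)"
  have "B > 0" using moves[of "(g ^^ M) s"] g_pow_between[OF s(1,2), of M] by (simp add: B_def)
  have est: "real (m ^ r) * e r \<le> \<rho> ^ r * B" "B \<le> \<rho> ^ r * (real (m ^ r) * e r)" for r
    using grid_estimate[OF s_in gs _ \<kappa>, of \<sigma> M U r] U fU gU \<sigma> unfolding \<sigma>\<rho> Fs B_def e_def by auto
  have "c * l r \<le> e r \<and> e r \<le> C * l r" for r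
  proof -
    have gs_in: "g s \<in> {0..1}" by (rule g.maps[OF s_in])
    have "s < (F ^^ r) (g s)" using f.inv_pow_less_iff[OF s_in gs_in, of r] gs Fs by simp
    moreover have "(F ^^ r) (g s) \<le> 1" using f.inv_pow_maps[OF gs_in, of r] by simp
    ultimately show ?thesis unfolding e_def l_def using cC(3,4) s_in by auto
  qed
  note el = this[THEN conjunct1] this[THEN conjunct2]
  have "real (m ^ r) * l r \<le> B / c * \<rho> ^ r" for r
  proof -
    have "c * (real (m ^ r) * l r) \<le> real (m ^ r) * e r"
      using mult_left_mono[OF el(1)[of r], of "real (m ^ r)"] by (simp add: mult_ac)
    also note est(1)[of r]
    finally show ?thesis using cC(1) by (simp add: field_simps)
  qed
  moreover have "B / C \<le> \<rho> ^ r * (real (m ^ r) * l r)" for r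
  proof -
    note est(2)[of r]
    also have "\<rho> ^ r * (real (m ^ r) * e r) \<le> \<rho> ^ r * (real (m ^ r) * (C * l r))"
      using \<rho> by (intro mult_left_mono el(2)) auto
    finally show ?thesis using cC(2) by (simp add: field_simps)
  qed
  moreover have "B / C > 0" using \<open>B > 0\<close> cC(2) by simp
  ultimately show ?thesis unfolding l_def by blast
qed

text \<open>By \<open>fixed_grid_bounds\<close>, both \<open>m ^ r * l r\<close> and its reciprocal
  grow subexponentially. The successive ratios of this sequence tend to \<open>m / f' s\<close>,
  which can therefore be neither above nor below 1.\<close>

lemma f_deriv_fixed:
  assumes s: "p < s" "s < q" "f s = s"
  shows "f' s = m"
proof -
  define l where "l = (\<lambda>r. (F ^^ r) (g s) - s)"
  define a where "a = (\<lambda>r. real (m ^ r) * l r)"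
  have s_in: "s \<in> {0..1}" by (rule between_in[OF s(1,2)])
  have gs_in: "g s \<in> {0..1}" by (rule g.maps[OF s_in])
  have Fs: "(F ^^ r) s = s" for r using f.inv_fixed_iff[OF s_in] s(3) by (simp add: f.inv_pow_fixed)
  have l_pos: "l r > 0" for r
    using f.inv_pow_less_iff[OF s_in gs_in, of r] moves[OF s(1,2)] Fs by (simp add: l_def)
  have a_pos: "a r > 0" for r using l_pos m by (simp add: a_def)
  have bounds: "\<exists>c>0. \<exists>C. \<forall>r. a r \<le> C * \<rho> ^ r \<and> c \<le> \<rho> ^ r * a r" if "\<rho> > 1" for \<rho>
    using fixed_grid_bounds[OF s that] by (simp add: a_def l_def)
  have "l \<longlonglongrightarrow> 0"
  proof -
    \<comment> \<open>Any rate strictly between 1 and \<open>m\<close> would do;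
      \<open>3 / 2\<close> works since \<open>m \<ge> 2\<close>.\<close>
    obtain C where C: "\<And>r. a r \<le> C * (3 / 2) ^ r" using bounds[of "3 / 2"] by auto
    have le: "l r \<le> C * (3 / (2 * real m)) ^ r" for r
      using C[of r] m by (simp add: a_def field_simps power_divide power_mult_distrib)
    have "(\<lambda>r. C * (3 / (2 * real m)) ^ r) \<longlonglongrightarrow> C * 0"
      using m by (intro tendsto_intros LIMSEQ_realpow_zero) auto
    then show ?thesis
      by (intro tendsto_sandwich[of "\<lambda>_. 0" l sequentially "\<lambda>r. C * (3 / (2 * real m)) ^ r" 0])
        (auto intro!: always_eventually le less_imp_le[OF l_pos])
  qed
  \<comment> \<open>Successive lengths have ratio \<open>f' \<xi>\<close> at a point squeezed
    towards \<open>s\<close>, so continuity of \<open>f'\<close> identifies the limit.\<close>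
  have "\<exists>\<xi>. s < \<xi> \<and> \<xi> < s + l (Suc r) \<and> l r = f' \<xi> * l (Suc r)" for r
  proof -
    obtain \<xi> where "s < \<xi>" "\<xi> < (F ^^ Suc r) (g s)"
      "f ((F ^^ Suc r) (g s)) - f s = f' \<xi> * ((F ^^ Suc r) (g s) - s)"
      using f.mvt[of s "(F ^^ Suc r) (g s)"] l_pos[of "Suc r"] s_in f.inv_pow_maps[OF gs_in, of "Suc r"]
      unfolding l_def by auto
    moreover have "f ((F ^^ Suc r) (g s)) = (F ^^ r) (g s)"
      using f.right_inv[OF f.inv_pow_maps[OF gs_in]] by simp
    ultimately show ?thesis using s(3) by (intro exI[of _ \<xi>]) (simp add: l_def)
  qed
  then obtain \<xi> where \<xi>: "\<And>r. s < \<xi> r" "\<And>r. \<xi> r < s + l (Suc r)" "\<And>r. l r = f' (\<xi> r) * l (Suc r)"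
    by metis
  have "(\<lambda>r. s + l (Suc r)) \<longlonglongrightarrow> s + 0" by (intro tendsto_intros LIMSEQ_Suc[OF \<open>l \<longlonglongrightarrow> 0\<close>])
  then have "\<xi> \<longlonglongrightarrow> s"
    by (intro tendsto_sandwich[of "\<lambda>_. s" \<xi> sequentially "\<lambda>r. s + l (Suc r)" s])
      (auto intro!: always_eventually less_imp_le \<xi>)
  moreover have \<xi>_in: "\<xi> r \<in> {0..1}" for r
    using \<xi>(1,2)[of r] s_in f.inv_pow_maps[OF gs_in, of "Suc r"] by (auto simp: l_def)
  ultimately have f\<xi>: "(\<lambda>r. f' (\<xi> r)) \<longlonglongrightarrow> f' s"
    by (intro continuous_on_tendsto_compose[OF f.cont_deriv _ s_in]) auto
  have ratio: "a (Suc r) / a r = m / f' (\<xi> r)" for r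
  proof -
    have "a r = real (m ^ r) * (f' (\<xi> r) * l (Suc r))" unfolding a_def by (simp only: \<xi>(3)[of r])
    then show ?thesis using l_pos[of "Suc r"] m f.deriv_pos[OF \<xi>_in[of r]] by (simp add: a_def)
  qed
  have fs: "f' s > 0" by (rule f.deriv_pos[OF s_in])
  have "m / f' s \<le> 1"
  proof (rule ratio_limit_le_1[of a, OF a_pos])
    show "(\<lambda>r. a (Suc r) / a r) \<longlonglongrightarrow> m / f' s"
      unfolding ratio using fs by (intro tendsto_intros f\<xi>) auto
  qed (use bounds in blast)
  moreover have "f' s / m \<le> 1"
  proof (rule ratio_limit_le_1[of "\<lambda>r. 1 / a r"])
    have "(1 / a (Suc r)) / (1 / a r) = f' (\<xi> r) / m" for r
      using ratio[of r] a_pos[of r] a_pos[of "Suc r"] m f.deriv_pos[OF \<xi>_in[of r]] by (simp add: field_simps)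
    then show "(\<lambda>r. (1 / a (Suc r)) / (1 / a r)) \<longlonglongrightarrow> f' s / m"
      using m by (auto intro!: tendsto_intros f\<xi>)
    fix \<rho> :: real assume "\<rho> > 1"
    then obtain c where c: "c > 0" "\<And>r. c \<le> \<rho> ^ r * a r" using bounds by blast
    have "1 / a r \<le> 1 / c * \<rho> ^ r" for r using c(1) c(2)[of r] a_pos[of r] by (simp add: field_simps)
    then show "\<exists>C. \<forall>r. 1 / a r \<le> C * \<rho> ^ r" by blast
  qed (use a_pos in auto)
  ultimately show ?thesis using fs m by (simp add: field_simps)
qed

end

section \<open>Components of moved points and their possible overlaps\<close>

text \<open>The nearest fixed points on either side exist by compactness, and a change of sign of
  \<open>f y - y\<close> between them would produce another fixed point.\<close>

lemma (in interval_diffeo) moved_component: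
  assumes x: "x \<in> {0..1}" "f x \<noteq> x"
  shows "\<exists>p q. 0 \<le> p \<and> p < x \<and> x < q \<and> q \<le> 1 \<and> f p = p \<and> f q = q \<and>
    ((\<forall>y. p < y \<longrightarrow> y < q \<longrightarrow> y < f y) \<or> (\<forall>y. p < y \<longrightarrow> y < q \<longrightarrow> f y < y))"
proof -
  have cl: "compact ({a..b} \<inter> {y. f y - y = 0})" if "0 \<le> a" "b \<le> 1" for a b
  proof -
    have "continuous_on {a..b} (\<lambda>y. f y - y)"
      by (intro continuous_intros continuous_on_subset[OF cont]) (use that in auto)
    then have "closed ({a..b} \<inter> (\<lambda>y. f y - y) -` {0})"
      by (intro continuous_closed_preimage) auto
    then have "compact ({a..b} \<inter> ({a..b} \<inter> (\<lambda>y. f y - y) -` {0}))"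
      by (intro compact_Int_closed) auto
    moreover have "{a..b} \<inter> ({a..b} \<inter> (\<lambda>y. f y - y) -` {0}) = {a..b} \<inter> {y. f y - y = 0}" by auto
    ultimately show ?thesis by simp
  qed
  have "{0..x} \<inter> {y. f y - y = 0} \<noteq> {}" "{x..1} \<inter> {y. f y - y = 0} \<noteq> {}"
    using x fixes_0 fixes_1 by (auto intro: exI[of _ 0] exI[of _ 1])
  then obtain p q where "p \<in> {0..x} \<inter> {y. f y - y = 0}" "\<forall>y\<in>{0..x} \<inter> {y. f y - y = 0}. y \<le> p"
    and "q \<in> {x..1} \<inter> {y. f y - y = 0}" "\<forall>y\<in>{x..1} \<inter> {y. f y - y = 0}. q \<le> y"
    using compact_attains_sup[OF cl[of 0 x]] compact_attains_inf[OF cl[of x 1]] x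
    by (meson atLeastAtMost_iff order_refl)
  then have p: "p \<in> {0..x}" "f p = p" "\<And>y. y \<in> {0..x} \<Longrightarrow> f y = y \<Longrightarrow> y \<le> p"
    and q: "q \<in> {x..1}" "f q = q" "\<And>y. y \<in> {x..1} \<Longrightarrow> f y = y \<Longrightarrow> q \<le> y"
    by auto
  have px: "p < x" "x < q" using p(1,2) q(1,2) x by (auto simp: less_le)
  have ne: "f y \<noteq> y" if "p < y" "y < q" for y
    using p(3)[of y] q(3)[of y] that p(1) q(1) by (cases "y \<le> x") auto
  have "\<not> (f u \<le> u \<and> v \<le> f v)" if "p < u" "u < q" "p < v" "v < q" for u v
  proof
    assume "f u \<le> u \<and> v \<le> f v"
    moreover have "continuous_on {min u v..max u v} f"
      by (rule continuous_on_subset[OF cont]) (use that p q in auto)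
    ultimately obtain w where "min u v \<le> w" "w \<le> max u v" "f w = w"
      using exists_fixed_point_between by blast
    then show False using ne[of w] that by (auto simp: min_def max_def split: if_splits)
  qed
  then have "(\<forall>y. p < y \<longrightarrow> y < q \<longrightarrow> y < f y) \<or> (\<forall>y. p < y \<longrightarrow> y < q \<longrightarrow> f y < y)"
    by (meson linorder_not_less)
  then show ?thesis using px p q by (intro exI[of _ p] exI[of _ q]) auto
qed

text \<open>Inverting both sides of the relation replaces \<open>g\<close> by its inverse and keeps
  the exponent \<open>m\<close>.\<close>

lemma (in bs_pair) bs_pair_inv:
  assumes "interval_diffeo G g G'"
  shows "bs_pair f F f' G g G' m"
proof -
  interpret G: interval_diffeo G g G' by (rule assms)
  show ?thesis
  proof unfold_locales
    fix x :: real assume x: "x \<in> {0..1}"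
    have "f x = (g ^^ m) (f (G x))" using rel[OF G.maps[OF x]] g.right_inv[OF x] by simp
    then show "f (G x) = (G ^^ m) (f x)"
      using g.inv_pow_pow[OF f.maps[OF G.maps[OF x]]] by simp
  qed (rule m)
qed

text \<open>The conclusion concerns \<open>f\<close> alone, so the downward case is the upward case
  for the inverse of \<open>g\<close>.\<close>

lemma (in bs_pair) component_dynamics:
  assumes G: "interval_diffeo G g G'"
    and pq: "0 \<le> p" "p < q" "q \<le> 1" "g p = p" "g q = q"
    and sign: "(\<forall>y. p < y \<longrightarrow> y < q \<longrightarrow> y < g y) \<or> (\<forall>y. p < y \<longrightarrow> y < q \<longrightarrow> g y < y)"
  shows "f p = p \<and> f q = q \<and> (\<exists>s. p < s \<and> s < q \<and> f s = s) \<and>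
    (\<forall>s. p < s \<longrightarrow> s < q \<longrightarrow> f s = s \<longrightarrow> f' s = m)"
  using sign
proof
  assume "\<forall>y. p < y \<longrightarrow> y < q \<longrightarrow> y < g y"
  then interpret bs_component f F f' g G g' m p q using pq by unfold_locales auto
  show ?thesis using f_fixes_ends exists_f_fixed f_deriv_fixed by blast
next
  assume neg: "\<forall>y. p < y \<longrightarrow> y < q \<longrightarrow> g y < y"
  have pq_in: "p \<in> {0..1}" "q \<in> {0..1}" using pq by auto
  have pos: "y < G y" if "p < y" "y < q" for y
  proof -
    have y: "y \<in> {0..1}" using that pq by auto
    then have "g y < g (G y)" using neg that g.right_inv by simp
    then show ?thesis using g.less_iff[OF y g.inv_maps[OF y]] by simp
  qed
  have "G p = p" "G q = q" using g.inv_fixed_iff pq_in pq by auto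
  moreover have "bs_pair f F f' G g G' m" by (rule bs_pair_inv[OF G])
  ultimately have c: "bs_component f F f' G g G' m p q"
    using pq pos by (simp add: bs_component_def bs_component_axioms_def)
  show ?thesis
    using bs_component.f_fixes_ends[OF c] bs_component.exists_f_fixed[OF c]
      bs_component.f_deriv_fixed[OF c] by blast
qed

lemma (in interval_diffeo) no_overlap:
  assumes m: "m \<ge> 2" and n: "n \<ge> 2" and mn: "m \<noteq> n"
    and x: "p < x" "x < q" "p' < x" "x < q'" and I: "0 \<le> p" "q \<le> 1" "0 \<le> p'" "q' \<le> 1"
    and fixed: "f p = p" "f q = q" "f p' = p'" "f q' = q'"
    and ex: "\<exists>s. p < s \<and> s < q \<and> f s = s" "\<exists>s. p' < s \<and> s < q' \<and> f s = s"
    and mult: "\<And>s. p < s \<Longrightarrow> s < q \<Longrightarrow> f s = s \<Longrightarrow> f' s = real m"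
      "\<And>s. p' < s \<Longrightarrow> s < q' \<Longrightarrow> f s = s \<Longrightarrow> f' s = real n"
  shows False
proof -
  have common: False if "p < w" "w < q" "p' < w" "w < q'" "f w = w" for w
    using mult(1)[of w] mult(2)[of w] that mn by simp
  obtain s where s: "p < s" "s < q" "f s = s" using ex(1) by blast
  obtain t where t: "p' < t" "t < q'" "f t = t" using ex(2) by blast
  consider "p < p'" | "p' < p" | "p = p'" by linarith
  then show False
  proof cases
    \<comment> \<open>Here \<open>p'\<close> lies inside \<open>(p, q)\<close>. The fixed point
      \<open>t\<close> cannot be common, so it lies at or beyond \<open>q\<close>, which puts
      \<open>q\<close> inside \<open>(p', q')\<close>. Both \<open>p'\<close> and \<open>q\<close>
      are thus expanding, and the fixed point between them is common.\<close>
    case 1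
    then have "f' p' = m" using mult(1)[of p'] x fixed by simp
    moreover have tq: "q \<le> t" using common[of t] t 1 by (meson less_trans not_le)
    then have "f' q = n" using mult(2)[of q] x fixed t by simp
    ultimately obtain w where w: "p' < w" "w < q" "f w = w"
      using fixed_point_between_expanding[of p' q] I x fixed m n by auto
    then show False using common[of w] 1 tq t by linarith
  next
    case 2
    then have "f' p = n" using mult(2)[of p] x fixed by simp
    moreover have tq: "q' \<le> s" using common[of s] s 2 by (meson less_trans not_le)
    then have "f' q' = m" using mult(1)[of q'] x fixed s by simp
    ultimately obtain w where w: "p < w" "w < q'" "f w = w"
      using fixed_point_between_expanding[of p q'] I x fixed m n by auto
    then show False using common[of w] 2 tq s by linarith
  next
    \<comment> \<open>With equal left ends one interval contains the other, and the fixed point in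
      the smaller one is common.\<close>
    case 3
    then show False using common[of s] common[of t] s t by linarith
  qed
qed

lemma bs_pairs_move_disjoint:
  assumes g: "bs_pair f F f' g G g' m" "interval_diffeo G g G'"
    and h: "bs_pair f F f' h H h' n" "interval_diffeo H h H'"
    and mn: "m \<noteq> n" and x: "x \<in> {0..1}"
  shows "g x = x \<or> h x = x"
proof (rule ccontr)
  assume moved: "\<not> (g x = x \<or> h x = x)"
  interpret g: bs_pair f F f' g G g' m by (rule g)
  interpret h: bs_pair f F f' h H h' n by (rule h)
  obtain p q where pq: "0 \<le> p" "p < x" "x < q" "q \<le> 1" "g p = p" "g q = q"
    "(\<forall>y. p < y \<longrightarrow> y < q \<longrightarrow> y < g y) \<or> (\<forall>y. p < y \<longrightarrow> y < q \<longrightarrow> g y < y)"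
    using g.g.moved_component[OF x] moved by blast
  obtain p' q' where pq': "0 \<le> p'" "p' < x" "x < q'" "q' \<le> 1" "h p' = p'" "h q' = q'"
    "(\<forall>y. p' < y \<longrightarrow> y < q' \<longrightarrow> y < h y) \<or> (\<forall>y. p' < y \<longrightarrow> y < q' \<longrightarrow> h y < y)"
    using h.g.moved_component[OF x] moved by blast
  note G = g.component_dynamics[OF g(2) pq(1) less_trans[OF pq(2,3)] pq(4-7)]
  note H = h.component_dynamics[OF h(2) pq'(1) less_trans[OF pq'(2,3)] pq'(4-7)]
  show False
    by (rule g.f.no_overlap[OF g.m h.m mn pq(2,3) pq'(2,3) pq(1,4) pq'(1,4)]) (use G H in auto)
qed

subsection \<open>The groups \<open>BS(1,m;1,n)\<close> and \<open>Diff\<^sup>1\<^sub>+([0,1])\<close>\<close>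

text \<open>The point at issue is \<open>f' x > 0\<close>: differentiability of the inverse makes
  \<open>f' x\<close> nonzero, and monotonicity makes it nonnegative.\<close>

lemma interval_diffeo_intro:
  assumes maps: "\<And>x. x \<in> {0..1} \<Longrightarrow> f x \<in> {0..1}" "\<And>x. x \<in> {0..1} \<Longrightarrow> F x \<in> {0..1}"
    and inv: "\<And>x. x \<in> {0..1} \<Longrightarrow> f (F x) = x" "\<And>x. x \<in> {0..1} \<Longrightarrow> F (f x) = x"
    and mono: "\<And>x y. x \<in> {0..1} \<Longrightarrow> y \<in> {0..1} \<Longrightarrow> x < y \<Longrightarrow> f x < f y"
    and C1: "C1_on_unit_interval f" "C1_on_unit_interval F"
  shows "\<exists>f'. interval_diffeo f F f'"
proof -
  obtain f' where f': "\<And>x. x \<in> {0..1} \<Longrightarrow> (f has_real_derivative f' x) (at x within {0..1})"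
    "continuous_on {0..1} f'" using C1(1) unfolding C1_on_unit_interval_def by blast
  obtain F' where F': "\<And>x. x \<in> {0..1} \<Longrightarrow> (F has_real_derivative F' x) (at x within {0..1})"
    using C1(2) unfolding C1_on_unit_interval_def by blast
  have "f' x > 0" if x: "x \<in> {0..1}" for x
  proof -
    have "f ` {0..1} \<subseteq> {0..1}" using maps(1) by blast
    then have "(F \<circ> f has_real_derivative F' (f x) * f' x) (at x within {0..1})"
      using maps(1)[OF x] by (intro DERIV_image_chain[OF _ f'(1)[OF x]] DERIV_subset[OF F'])
    then have "((\<lambda>x. x) has_real_derivative F' (f x) * f' x) (at x within {0..1})"
      by (rule has_field_derivative_transform_within[OF _ zero_less_one x]) (simp add: inv)
    then have "F' (f x) * f' x = 1"
      by (rule has_real_derivative_unique_unit_interval[OF x]) (rule DERIV_ident)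
    then have "f' x \<noteq> 0" by auto
    moreover have "0 \<le> f' x"
    proof (rule tendsto_lowerbound)
      show "((\<lambda>y. (f y - f x) / (y - x)) \<longlongrightarrow> f' x) (at x within {0..1})"
        using f'(1)[OF x] unfolding has_field_derivative_iff .
      have "0 \<le> (f y - f x) / (y - x)" if "y \<in> {0..1}" "y \<noteq> x" for y
      proof (cases "y < x")
        case True
        then show ?thesis using mono[OF that(1) x] by (simp add: divide_nonpos_neg)
      next
        case False
        then show ?thesis using mono[OF x that(1)] that(2) by simp
      qed
      then show "\<forall>\<^sub>F y in at x within {0..1}. 0 \<le> (f y - f x) / (y - x)"
        by (auto simp: eventually_at_filter)
      show "at x within {0..1} \<noteq> bot" using x by (simp add: trivial_limit_within)
    qed
    ultimately show ?thesis by simp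
  qed
  then have "interval_diffeo f F f'"
    using maps inv mono f' by unfold_locales blast+
  then show ?thesis by blast
qed

lemma Diff1_plus_interval_diffeo:
  assumes "f \<in> carrier Diff1_plus"
  shows "\<exists>f'. interval_diffeo f (inv_into {0..1} f) f'" "\<exists>F'. interval_diffeo (inv_into {0..1} f) f F'"
proof -
  let ?F = "inv_into {0..1} f"
  have fB: "f \<in> Bij {0..1}" and bij: "bij_betw f {0..1} {0..1}" and C1: "C1_on_unit_interval f" "C1_on_unit_interval ?F"
    and mono: "strict_mono_on {0..1} f"
    using assms by (auto simp: Diff1_plus_def Bij_def)
  have maps: "f x \<in> {0..1}" "?F x \<in> {0..1}" and inv: "f (?F x) = x" "?F (f x) = x" if "x \<in> {0..1}" for x
    using that bij Bij_inv_into_mem[OF fB] bij_betw_inv_into_right[OF bij] bij_betw_inv_into_left[OF bij]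
    by (blast dest: bij_betwE)+
  have monoF: "?F x < ?F y" if "x \<in> {0..1}" "y \<in> {0..1}" "x < y" for x y
    using that inv(1) maps(2) strict_mono_on_leD[OF mono, of "?F y" "?F x"] by (metis not_le)
  show "\<exists>f'. interval_diffeo f ?F f'"
    by (rule interval_diffeo_intro) (use maps inv C1 strict_mono_onD[OF mono] in blast)+
  show "\<exists>F'. interval_diffeo ?F f F'"
    by (rule interval_diffeo_intro) (use maps inv C1 monoF in blast)+
qed

lemma Diff1_plus_mult: "f \<in> carrier Diff1_plus \<Longrightarrow> g \<in> carrier Diff1_plus \<Longrightarrow>
    f \<otimes>\<^bsub>Diff1_plus\<^esub> g = compose {0..1} f g"
  by (simp add: Diff1_plus_def BijGroup_def)

lemma Diff1_plus_one: "\<one>\<^bsub>Diff1_plus\<^esub> = (\<lambda>x\<in>{0..1}. x)"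
  by (simp add: Diff1_plus_def BijGroup_def)

section \<open>A linear representation in which \<open>b\<close> and \<open>c\<close> do not
  commute\<close>

text \<open>
  The representation of \<open>BS m n\<close> on \<open>\<real>\<^sup>3\<close> by the matrices
  \<open>a = diag (m n, n, 1)\<close>, \<open>b = 1 + E\<^sub>1\<^sub>2\<close>, \<open>c = 1 + E\<^sub>2\<^sub>3\<close> separates \<open>b c\<close> from \<open>c b\<close>.
\<close>

fun heis_letter :: "real \<Rightarrow> real \<Rightarrow> bs_gen \<times> bool \<Rightarrow> real \<times> real \<times> real \<Rightarrow> real \<times> real \<times> real" where
  "heis_letter m n (Gen_a, e) (x, y, z) = (if e then (m * n * x, n * y, z) else (x / (m * n), y / n, z))"
| "heis_letter m n (Gen_b, e) (x, y, z) = (if e then x + y else x - y, y, z)"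
| "heis_letter m n (Gen_c, e) (x, y, z) = (x, if e then y + z else y - z, z)"

definition heis_word :: "real \<Rightarrow> real \<Rightarrow> bs_gen gword \<Rightarrow> real \<times> real \<times> real \<Rightarrow> real \<times> real \<times> real" where
  "heis_word m n w = foldr (heis_letter m n) w"

lemma heis_word_replicate_b: "heis_word m n (replicate k (Gen_b, True)) (x, y, z) = (x + real k * y, y, z)"
  by (induction k) (auto simp: heis_word_def algebra_simps)

lemma heis_word_replicate_c: "heis_word m n (replicate k (Gen_c, True)) (x, y, z) = (x, y + real k * z, z)"
  by (induction k) (auto simp: heis_word_def algebra_simps)

lemma heis_word_eq:
  assumes "m > 0" "n > 0" "word_eq (bs_relations m n) u v"
  shows "heis_word m n u = heis_word m n v"
  using assms(3)
proof (induction rule: word_eq.induct)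
  case (cancel u x e v)
  have "heis_letter m n (x, e) (heis_letter m n (x, \<not> e) t) = t" for t
    using assms(1,2) by (cases t; cases x; cases e) auto
  then show ?case by (simp add: heis_word_def fun_eq_iff)
next
  case (relation l r u v)
  have "heis_word m n l t = heis_word m n r t" for t
    using relation assms(1,2) by (cases t)
      (auto simp: bs_relations_def heis_word_replicate_b heis_word_replicate_c,
       auto simp: heis_word_def field_simps)
  then show ?case by (simp add: heis_word_def fun_eq_iff)
qed auto

lemma BS_gens_not_commute:
  assumes "m > 0" "n > 0"
  shows "BS_gen m n Gen_b \<otimes>\<^bsub>BS m n\<^esub> BS_gen m n Gen_c \<noteq> BS_gen m n Gen_c \<otimes>\<^bsub>BS m n\<^esub> BS_gen m n Gen_b"
proof
  assume "BS_gen m n Gen_b \<otimes>\<^bsub>BS m n\<^esub> BS_gen m n Gen_c = BS_gen m n Gen_c \<otimes>\<^bsub>BS m n\<^esub> BS_gen m n Gen_b"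
  then have "word_eq (bs_relations m n) [(Gen_b, True), (Gen_c, True)] [(Gen_c, True), (Gen_b, True)]"
    by (simp add: BS_gen_def BS_def presented_group_mult word_class_eq_iff)
  from heis_word_eq[OF assms this]
  \<comment> \<open>The third basis vector goes to \<open>(1, 1, 1)\<close> under \<open>b c\<close>
    and to \<open>(0, 1, 1)\<close> under \<open>c b\<close>.\<close>
  have "heis_word m n [(Gen_b, True), (Gen_c, True)] (0, 0, 1) = heis_word m n [(Gen_c, True), (Gen_b, True)] (0, 0, 1)"
    by simp
  then show False by (simp add: heis_word_def)
qed

section \<open>The relations as identities between maps\<close>

text \<open>Multiplying by \<open>a\<close> on the right removes the inverse letter, which gives the
  form that \<open>bs_pair\<close> asks for.\<close>

lemma BS_relation_a:
  assumes "([(Gen_a, True), (x, True), (Gen_a, False)], replicate k (x, True)) \<in> bs_relations m n"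
  shows "BS_gen m n Gen_a \<otimes>\<^bsub>BS m n\<^esub> BS_gen m n x =
    word_class (bs_relations m n) (replicate k (x, True)) \<otimes>\<^bsub>BS m n\<^esub> BS_gen m n Gen_a"
proof -
  let ?R = "bs_relations m n"
  have "word_eq ?R ([(Gen_a, True), (x, True)] @ [(Gen_a, False), (Gen_a, \<not> False)] @ [])
      ([(Gen_a, True), (x, True)] @ [])"
    by (rule word_eq.cancel)
  moreover have "word_eq ?R ([] @ [(Gen_a, True), (x, True), (Gen_a, False)] @ [(Gen_a, True)])
      ([] @ replicate k (x, True) @ [(Gen_a, True)])"
    by (rule word_eq.relation[OF assms])
  ultimately have "word_eq ?R [(Gen_a, True), (x, True)] (replicate k (x, True) @ [(Gen_a, True)])"
    by (auto intro: word_eq.trans word_eq.sym)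
  then show ?thesis by (simp add: BS_gen_def BS_def presented_group_mult word_class_eq_iff)
qed

lemma word_class_in_BS: "word_class (bs_relations m n) w \<in> carrier (BS m n)"
  by (simp add: BS_def presented_group_def)

lemma BS_gen_in: "BS_gen m n x \<in> carrier (BS m n)"
  unfolding BS_gen_def by (rule word_class_in_BS)

context
  fixes m n :: nat and \<phi> :: "bs_gen gword set \<Rightarrow> real \<Rightarrow> real"
  assumes \<phi>: "\<phi> \<in> hom (BS m n) Diff1_plus"
begin

lemma rep_in: "A \<in> carrier (BS m n) \<Longrightarrow> \<phi> A \<in> carrier Diff1_plus"
  using \<phi> by (auto simp: hom_def)

lemma rep_mult:
  assumes "A \<in> carrier (BS m n)" "B \<in> carrier (BS m n)"
  shows "\<phi> (A \<otimes>\<^bsub>BS m n\<^esub> B) = compose {0..1} (\<phi> A) (\<phi> B)"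
  using \<phi> assms Diff1_plus_mult[OF rep_in rep_in] by (simp add: hom_def)

lemma rep_maps:
  assumes "A \<in> carrier (BS m n)" "t \<in> {0..1}"
  shows "\<phi> A t \<in> {0..1}"
  using Diff1_plus_interval_diffeo(1)[OF rep_in[OF assms(1)]] interval_diffeo.maps assms(2) by blast

lemma rep_replicate:
  assumes "t \<in> {0..1}"
  shows "\<phi> (word_class (bs_relations m n) (replicate k (x, True))) t = (\<phi> (BS_gen m n x) ^^ k) t"
proof (induction k)
  case 0
  interpret group_hom "BS m n" Diff1_plus \<phi>
    using \<phi> group_Diff1_plus group_presented_group
    by (simp add: group_hom_def group_hom_axioms_def BS_def)
  have "word_class (bs_relations m n) [] = \<one>\<^bsub>BS m n\<^esub>" by (simp add: BS_def presented_group_def)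
  then show ?case using assms hom_one by (simp add: Diff1_plus_one)
next
  case (Suc k)
  have "word_class (bs_relations m n) (replicate (Suc k) (x, True)) =
      BS_gen m n x \<otimes>\<^bsub>BS m n\<^esub> word_class (bs_relations m n) (replicate k (x, True))"
    by (simp add: BS_gen_def BS_def presented_group_mult)
  then show ?case
    using Suc assms by (simp add: rep_mult BS_gen_in word_class_in_BS compose_eq)
qed

lemma rep_relation:
  assumes "([(Gen_a, True), (x, True), (Gen_a, False)], replicate k (x, True)) \<in> bs_relations m n"
    and t: "t \<in> {0..1}"
  shows "\<phi> (BS_gen m n Gen_a) (\<phi> (BS_gen m n x) t) = (\<phi> (BS_gen m n x) ^^ k) (\<phi> (BS_gen m n Gen_a) t)"
proof -
  have "\<phi> (BS_gen m n Gen_a \<otimes>\<^bsub>BS m n\<^esub> BS_gen m n x) t =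
      \<phi> (word_class (bs_relations m n) (replicate k (x, True)) \<otimes>\<^bsub>BS m n\<^esub> BS_gen m n Gen_a) t"
    by (simp only: BS_relation_a[OF assms(1)])
  then show ?thesis
    using t rep_maps[OF BS_gen_in t]
    by (simp add: rep_mult BS_gen_in word_class_in_BS compose_eq rep_replicate del: atLeastAtMost_iff)
qed

end

section \<open>Interiors of supports and the conclusion\<close>

text \<open>The set moved by \<open>g\<close> is relatively open. An open set meeting a closure
  meets the set itself; using this twice turns a common interior point into a point moved by both
  maps.\<close>

lemma interior_supports_disjoint:
  assumes cont: "continuous_on {0..1} g"
    and disj: "\<And>x. x \<in> {0..1} \<Longrightarrow> g x = x \<or> h x = x"
  shows "(top_of_set {0..1} interior_of diffeo_support g) \<inter>
    (top_of_set {0..1} interior_of diffeo_support h) = {}"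
proof (rule ccontr)
  let ?A = "{x \<in> {0..1}. g x \<noteq> x}" and ?B = "{x \<in> {0..1}. h x \<noteq> x}"
  assume "\<not> ?thesis"
  then obtain z S T where z: "z \<in> S" "z \<in> T" and S: "openin (top_of_set {0..1}) S" "S \<subseteq> closure ?A"
    and T: "openin (top_of_set {0..1}) T" "T \<subseteq> closure ?B"
    unfolding interior_of_def diffeo_support_def by blast
  obtain U V where U: "open U" "S = {0..1} \<inter> U" and V: "open V" "T = {0..1} \<inter> V"
    using S(1) T(1) by (auto simp: openin_open)
  have "openin (top_of_set {0..1}) ({0..1} \<inter> (\<lambda>x. g x - x) -` (- {0}))"
    by (intro continuous_openin_preimage_gen continuous_intros cont)
  moreover have "{0..1} \<inter> (\<lambda>x. g x - x) -` (- {0}) = ?A" by auto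
  ultimately obtain W where W: "open W" "?A = {0..1} \<inter> W" by (auto simp: openin_open)
  \<comment> \<open>The first use finds \<open>a\<close> moved by \<open>g\<close> and still in the
    closure of \<open>?B\<close>; the second use, with \<open>W\<close>, finds \<open>b\<close>
    moved by both.\<close>
  have "U \<inter> V \<inter> closure ?A \<noteq> {}" using z U V S by blast
  then obtain a where a: "a \<in> U \<inter> V \<inter> ?A"
    using open_Int_closure_eq_empty[of "U \<inter> V" ?A] U V by blast
  then have "a \<in> W \<inter> closure ?B" using W V T by blast
  then have "W \<inter> closure ?B \<noteq> {}" by blast
  then obtain b where "b \<in> W \<inter> ?B"
    using open_Int_closure_eq_empty[OF W(1), of ?B] by blast
  then have "b \<in> ?A" "b \<in> ?B" using W(2) by auto
  then show False using disj[of b] by auto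
qed

text \<open>Interiors are relative to \<open>[0,1]\<close>, which is stronger than disjointness of
  interiors in the real line. The exponents start at 2: for \<open>m = 1\<close> the elements
  \<open>a\<close> and \<open>b\<close> could act by the same map, and the affine action of
  \<open>a\<close> and \<open>c\<close> on the projective line cut open at infinity would give
  overlapping supports.\<close>

theorem theorem1p11:
  fixes m n :: nat
    and \<phi> :: "bs_gen gword set \<Rightarrow> real \<Rightarrow> real"
    and f g h :: "real \<Rightarrow> real"
  assumes "m \<ge> 2" and "n \<ge> 2" and "m \<noteq> n"
    and "\<phi> \<in> hom (BS m n) Diff1_plus"
    and "f = \<phi> (BS_gen m n Gen_a)"
    and "g = \<phi> (BS_gen m n Gen_b)"
    and "h = \<phi> (BS_gen m n Gen_c)"
  shows "(top_of_set {0..1} interior_of diffeo_support g) \<inter>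
           (top_of_set {0..1} interior_of diffeo_support h) = {} \<and>
         g \<otimes>\<^bsub>Diff1_plus\<^esub> h = h \<otimes>\<^bsub>Diff1_plus\<^esub> g \<and>
         \<not> inj_on \<phi> (carrier (BS m n))"
proof -
  note \<phi> = assms(4) and f = assms(5) and g = assms(6) and h = assms(7)
  have car: "f \<in> carrier Diff1_plus" "g \<in> carrier Diff1_plus" "h \<in> carrier Diff1_plus"
    unfolding f g h by (intro rep_in[OF \<phi>] BS_gen_in)+
  let ?i = "inv_into {0..1::real}"
  obtain f' g' G' h' H' where df: "interval_diffeo f (?i f) f'"
    and dg: "interval_diffeo g (?i g) g'" "interval_diffeo (?i g) g G'"
    and dh: "interval_diffeo h (?i h) h'" "interval_diffeo (?i h) h H'"
    using Diff1_plus_interval_diffeo car by meson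
  have fg: "bs_pair f (?i f) f' g (?i g) g' m"
    unfolding bs_pair_def bs_pair_axioms_def f g
    using df dg assms(1) rep_relation[OF \<phi>] by (auto simp: f g bs_relations_def simp del: atLeastAtMost_iff)
  have fh: "bs_pair f (?i f) f' h (?i h) h' n"
    unfolding bs_pair_def bs_pair_axioms_def f h
    using df dh assms(2) rep_relation[OF \<phi>] by (auto simp: f h bs_relations_def simp del: atLeastAtMost_iff)
  have disj: "g x = x \<or> h x = x" if "x \<in> {0..1}" for x
    by (rule bs_pairs_move_disjoint[OF fg dg(2) fh dh(2) assms(3) that])
  interpret g: interval_diffeo g "?i g" g' by (rule dg)
  interpret h: interval_diffeo h "?i h" h' by (rule dh)
  \<comment> \<open>If \<open>g\<close> moves \<open>x\<close>, then by injectivity it also moves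
    \<open>g x\<close>, so \<open>h\<close> fixes both points; the case where \<open>h\<close> moves
    \<open>x\<close> is symmetric.\<close>
  have "g (h x) = h (g x)" if x: "x \<in> {0..1}" for x
    using disj[OF x] disj[OF g.maps[OF x]] disj[OF h.maps[OF x]] g.eq_iff[OF g.maps[OF x] x]
      h.eq_iff[OF h.maps[OF x] x] by metis
  then have "compose {0..1} g h = compose {0..1} h g" by (auto simp: compose_def fun_eq_iff)
  then have comm: "g \<otimes>\<^bsub>Diff1_plus\<^esub> h = h \<otimes>\<^bsub>Diff1_plus\<^esub> g" by (simp add: Diff1_plus_mult car)
  have "\<not> inj_on \<phi> (carrier (BS m n))"
  proof
    assume inj: "inj_on \<phi> (carrier (BS m n))"
    have "BS_gen m n x \<otimes>\<^bsub>BS m n\<^esub> BS_gen m n y \<in> carrier (BS m n)" for x y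
      unfolding BS_def using BS_gen_in[unfolded BS_def]
      by (intro monoid.m_closed group.is_monoid group_presented_group)
    moreover have "\<phi> (BS_gen m n Gen_b \<otimes>\<^bsub>BS m n\<^esub> BS_gen m n Gen_c) =
        \<phi> (BS_gen m n Gen_c \<otimes>\<^bsub>BS m n\<^esub> BS_gen m n Gen_b)"
      using comm \<phi> by (simp add: hom_mult BS_gen_in g h)
    ultimately have "BS_gen m n Gen_b \<otimes>\<^bsub>BS m n\<^esub> BS_gen m n Gen_c =
        BS_gen m n Gen_c \<otimes>\<^bsub>BS m n\<^esub> BS_gen m n Gen_b"
      using inj by (meson inj_onD)
    then show False using BS_gens_not_commute assms(1,2) by simp
  qed
  then show ?thesis using interior_supports_disjoint[OF g.cont disj] comm by blast
qed

end
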